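(* Let $\beta>0$ and let $h\in\mathcal{G}_0$ be a $\mathcal{C}^2$-isomorphism of $[0,1]$. Then the translation $\tau_h:\mathcal{G}_0\to\mathcal{G}_0$, $g\mapsto h\circ g$, leaves $\mathbb{Q}_0^\beta$ quasi-invariant: $$\frac{d(\tau_{h^{-1}})_*\mathbb{Q}_0^\beta}{d\mathbb{Q}_0^\beta}(g)=Y^\beta_{h,0}(g).$$ The function $Y^\beta_{h,0}$ is bounded from above and from below away from $0$ on $\mathcal{G}_0$.
   Context: $\mathcal{G}_0$ is the set of right continuous nondecreasing maps $g:[0,1[\,\to[0,1]$, each extended by $g(1):=1$. $\mathbb{Q}_0^\beta$ is the probability measure on $\mathcal{G}_0$ such that for every $N$ and $0=t_0<t_1<\dots<t_N<t_{N+1}=1$ the law of $(g(t_1),\dots,g(t_N))$ is $\frac{\Gamma(\beta)}{\prod_{i=0}^{N}\Gamma(\beta(t_{i+1}-t_i))}\prod_{i=0}^{N}(x_{i+1}-x_i)^{\beta(t_{i+1}-t_i)-1}dx_1\cdots dx_N$ on $\{0<x_1<\dots<x_N<1\}$, $x_0:=0,x_{N+1}:=1$. A $\mathcal{C}^2$-isomorphism $h\in\mathcal{G}_0$ is an increasing homeomorphism $h:[0,1]\to[0,1]$ such that $h$ and $h^{-1}$ are bounded in $\mathcal{C}^2([0,1])$ (so $h'>0$). For such $h$ and $g\in\mathcal{G}_0$, let $J_g\subset\,]0,1[$ be the set of jump locations of $g$, $\frac{\delta(h\circ g)}{\delta g}(a):=\frac{h(g(a+))-h(g(a-))}{g(a+)-g(a-)}$,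 $$Y_h^0(g):=\prod_{a\in J_g}\frac{\sqrt{h'(g(a-))h'(g(a+))}}{\frac{\delta(h\circ g)}{\delta g}(a)},\quad X_h^\beta(g):=\exp\Big(\beta\int_0^1\log h'(g(s))ds\Big),\quad Y^\beta_{h,0}(g):=X_h^\beta(g)\cdot\frac{1}{\sqrt{h'(0)h'(1)}}\cdot Y_h^0(g).$$ *)

theory Defs
  imports "HOL-Probability.Probability"
begin

text \<open>The space G_0: right continuous nondecreasing maps g on [0,1[ with values in [0,1],
  extended by g(1) = 1. Functions are represented as real => real; as a canonical
  representative we set g t = 1 for every t outside [0,1[.\<close>

definition G0 :: "(real \<Rightarrow> real) set" where
  "G0 = {g. (\<forall>t\<in>{0..<1}. g t \<in> {0..1}) \<and> mono_on {0..<1} g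
            \<and> (\<forall>t\<in>{0..<1}. continuous (at_right t) g)
            \<and> (\<forall>t. t \<notin> {0..<1} \<longrightarrow> g t = 1)}"

definition G0M :: "(real \<Rightarrow> real) measure" where
  "G0M = restrict_space (Pi\<^sub>M UNIV (\<lambda>_. borel)) G0"

definition ext01 :: "nat \<Rightarrow> (nat \<Rightarrow> real) \<Rightarrow> nat \<Rightarrow> real" where
  "ext01 N x i = (if i = 0 then 0 else if i = N + 1 then 1 else x i)"

definition dirichlet_fdd_density ::
  "real \<Rightarrow> nat \<Rightarrow> (nat \<Rightarrow> real) \<Rightarrow> (nat \<Rightarrow> real) \<Rightarrow> real" where
  "dirichlet_fdd_density \<beta> N t x =
     (if (\<forall>i\<le>N. ext01 N x i < ext01 N x (i + 1))
      then Gamma \<beta> / (\<Prod>i\<le>N. Gamma (\<beta> * (ext01 N t (i + 1) - ext01 N t i)))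
           * (\<Prod>i\<le>N. (ext01 N x (i + 1) - ext01 N x i)
                       powr (\<beta> * (ext01 N t (i + 1) - ext01 N t i) - 1))
      else 0)"

definition is_Q0 :: "real \<Rightarrow> (real \<Rightarrow> real) measure \<Rightarrow> bool" where
  "is_Q0 \<beta> Q \<longleftrightarrow> prob_space Q \<and> sets Q = sets G0M \<and>
     (\<forall>N::nat. \<forall>t::nat \<Rightarrow> real.
        (\<forall>i\<le>N. ext01 N t i < ext01 N t (i + 1)) \<longrightarrow>
        distr Q (Pi\<^sub>M {1..N} (\<lambda>_. lborel)) (\<lambda>g. \<lambda>i\<in>{1..N}. g (t i)) =
        density (Pi\<^sub>M {1..N} (\<lambda>_. lborel))
                (\<lambda>x. ennreal (dirichlet_fdd_density \<beta> N t x)))"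

definition C2_on01 :: "(real \<Rightarrow> real) \<Rightarrow> (real \<Rightarrow> real) \<Rightarrow> bool" where
  "C2_on01 f f' \<longleftrightarrow> (\<exists>f''. continuous_on {0..1} f' \<and> continuous_on {0..1} f'' \<and>
      (\<forall>x\<in>{0..1}. (f has_real_derivative f' x) (at x within {0..1}) \<and>
                   (f' has_real_derivative f'' x) (at x within {0..1})))"

definition C2_iso :: "(real \<Rightarrow> real) \<Rightarrow> (real \<Rightarrow> real) \<Rightarrow> bool" where
  "C2_iso h h' \<longleftrightarrow> strict_mono_on {0..1} h \<and> h ` {0..1} = {0..1} \<and>
      h 0 = 0 \<and> h 1 = 1 \<and> C2_on01 h h' \<and> (\<forall>x\<in>{0..1}. h' x > 0) \<and>
      (\<exists>k'. C2_on01 (the_inv_into {0..1} h) k')"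

definition left_lim :: "(real \<Rightarrow> real) \<Rightarrow> real \<Rightarrow> real" where
  "left_lim g a = Lim (at_left a) g"

definition jumps :: "(real \<Rightarrow> real) \<Rightarrow> real set" where
  "jumps g = {a \<in> {0<..<1}. left_lim g a \<noteq> g a}"

definition jump_factor :: "(real \<Rightarrow> real) \<Rightarrow> (real \<Rightarrow> real) \<Rightarrow> (real \<Rightarrow> real) \<Rightarrow> real \<Rightarrow> real" where
  "jump_factor h h' g a =
     sqrt (h' (left_lim g a) * h' (g a)) /
     ((h (g a) - h (left_lim g a)) / (g a - left_lim g a))"

text \<open>The (countable, absolutely convergent) product over the jumps, written as the
  exponential of the sum of the logarithms of the (positive) factors.\<close>

definition Y0 :: "(real \<Rightarrow> real) \<Rightarrow> (real \<Rightarrow> real) \<Rightarrow> (real \<Rightarrow> real) \<Rightarrow> real" where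
  "Y0 h h' g = exp (\<Sum>\<^sub>\<infinity>a\<in>jumps g. ln (jump_factor h h' g a))"

definition Xb :: "real \<Rightarrow> (real \<Rightarrow> real) \<Rightarrow> (real \<Rightarrow> real) \<Rightarrow> real" where
  "Xb \<beta> h' g = exp (\<beta> * integral {0..1} (\<lambda>s. ln (h' (g s))))"

definition Yb0 :: "real \<Rightarrow> (real \<Rightarrow> real) \<Rightarrow> (real \<Rightarrow> real) \<Rightarrow> (real \<Rightarrow> real) \<Rightarrow> real" where
  "Yb0 \<beta> h h' g = Xb \<beta> h' g * (1 / sqrt (h' 0 * h' 1)) * Y0 h h' g"

end

theory Submission
  imports Defs
begin

text \<open>On the grid \<open>i / n\<close> the Dirichlet marginals are transformed by \<open>h\<close> with the explicit density
  \<open>exp (\<beta> * \<Lambda>\<^sub>n g + \<Phi>\<^sub>n g) / sqrt (h' 0 * h' 1)\<close>, where \<open>\<Lambda>\<^sub>n g\<close> is the average of the logarithmic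
  difference quotients \<open>ln q\<close> of \<open>h\<close> along \<open>g\<close>, and \<open>\<Phi>\<^sub>n g\<close> sums
  \<open>phi x y = (ln (h' x) + ln (h' y)) / 2 - ln (q x y)\<close> over the increments of \<open>g\<close>. As \<open>h\<close> is
  twice continuously differentiable, \<open>phi x y = o(y - x)\<close>, so only the jumps of \<open>g\<close> contribute to
  the limit of \<open>\<Phi>\<^sub>n\<close>, while \<open>\<Lambda>\<^sub>n\<close> is a Riemann sum. Both are uniformly bounded, so dominated
  convergence transfers the identity to the limit. The means \<open>t\<close> of the Beta marginals give
  \<open>g 0 = 0\<close> and \<open>g(1-) = 1\<close> almost surely, i.e. no mass is lost at the endpoints.\<close>

section \<open>Difference quotients of \<open>C\<^sup>2\<close> functions\<close>

text \<open>The endpoint factor comes from a count: \<open>N\<close> interior grid points contribute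
  a Jacobian factor \<open>h'\<close> each, whereas \<open>N + 1\<close> increments contribute
  \<open>q powr (e - 1)\<close>. Splitting each interior \<open>ln (h' z)\<close> evenly between its
  two neighbouring increments produces exactly the terms \<open>phi\<close>; the halves missing at 0
  and 1 are \<open>1 / sqrt (h' 0 * h' 1)\<close>. The obstacle is a sum over ever more increments,
  most of them small. Instead of separating large from small jumps, \<open>phi x y\<close> is
  written as \<open>(y - x) * psi x y\<close>, where \<open>psi\<close> is bounded, continuous on
  the closed triangle \<open>x \<le> y\<close> and zero on the diagonal. The sum becomes an integral
  over the range of \<open>g\<close>, so dominated convergence applies. Since the increments of a
  path add up to at most 1, the same factorization gives the bounds on all of \<open>G0\<close>, not
  just almost everywhere. The endpoints need care because \<open>jumps\<close> only sees the open
  interval: a jump at 0 or 1 would enter the grid densities but not \<open>Y0\<close>.\<close>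

lemma lim_in_01:
  fixes X :: "nat \<Rightarrow> real"
  assumes "X \<longlonglongrightarrow> x" "\<And>n. X n \<in> {0..1}"
  shows "x \<in> {0..1}"
  using LIMSEQ_le_const[OF assms(1), of 0] LIMSEQ_le_const2[OF assms(1), of 1] assms(2) by auto

lemma tendsto_within_01:
  assumes "continuous_on {0..1::real} f" "X \<longlonglongrightarrow> x" "\<And>n. X n \<in> {0..1}"
  shows "(\<lambda>n. f (X n) :: real) \<longlonglongrightarrow> f x"
proof -
  have "x \<in> {0..1}"
    using assms lim_in_01 by blast
  then show ?thesis
    using assms continuous_on_tendsto_compose[of "{0..1}" f X x sequentially] by auto
qed

text \<open>The second derivative is only existentially quantified in \<open>C2_on01\<close>; it
  becomes a parameter here so that it can be evaluated at intermediate points and bounded.\<close>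

locale C2_iso01 =
  fixes h h' h'' :: "real \<Rightarrow> real"
  assumes h_mono: "strict_mono_on {0..1} h"
    and h_onto: "h ` {0..1} = {0..1}"
    and h_0 [simp]: "h 0 = 0" and h_1 [simp]: "h 1 = 1"
    and cont_h': "continuous_on {0..1} h'" and cont_h'': "continuous_on {0..1} h''"
    and deriv_h: "\<And>x. x \<in> {0..1} \<Longrightarrow> (h has_real_derivative h' x) (at x within {0..1})"
    and deriv_h': "\<And>x. x \<in> {0..1} \<Longrightarrow> (h' has_real_derivative h'' x) (at x within {0..1})"
    and h'_pos: "\<And>x. x \<in> {0..1} \<Longrightarrow> 0 < h' x"
begin

text \<open>The diagonal value is the continuous extension. It is needed in the limit, where both
  ends of a grid cell tend to the same value of a path.\<close>

definition q :: "real \<Rightarrow> real \<Rightarrow> real" where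
  "q x y = (if x = y then h' x else (h y - h x) / (y - x))"

text \<open>This is the logarithm of \<open>jump_factor\<close> for a jump from \<open>x\<close> to
  \<open>y\<close>, see \<open>ln_jump_factor\<close>.\<close>

definition phi :: "real \<Rightarrow> real \<Rightarrow> real" where
  "phi x y = (ln (h' x) + ln (h' y)) / 2 - ln (q x y)"

lemma cont_h: "continuous_on {0..1} h"
  using deriv_h by (meson DERIV_continuous_on)

lemma deriv_h_at: "0 < x \<Longrightarrow> x < 1 \<Longrightarrow> (h has_real_derivative h' x) (at x)"
  using deriv_h[of x] at_within_interior[of x "{0..1}"] by (simp add: interior_atLeastAtMost_real)

lemma deriv_h'_at: "0 < x \<Longrightarrow> x < 1 \<Longrightarrow> (h' has_real_derivative h'' x) (at x)"
  using deriv_h'[of x] at_within_interior[of x "{0..1}"] by (simp add: interior_atLeastAtMost_real)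

lemma h_mvt:
  assumes "0 \<le> x" "x < y" "y \<le> 1"
  obtains t where "x < t" "t < y" "h y - h x = h' t * (y - x)"
proof -
  have "continuous_on {x..y} h"
    using cont_h by (rule continuous_on_subset) (use assms in auto)
  moreover have "h differentiable (at t)" if "x < t" "t < y" for t
    using deriv_h_at[of t] that assms by (auto simp: real_differentiable_def)
  ultimately obtain l z where "x < z" "z < y" "DERIV h z :> l" "h y - h x = (y - x) * l"
    using MVT[of x y h] assms by blast
  moreover have "l = h' z"
    using DERIV_unique[OF \<open>DERIV h z :> l\<close> deriv_h_at[of z]] \<open>x < z\<close> \<open>z < y\<close> assms by simp
  ultimately show thesis
    using that[of z] by (simp add: mult.commute)
qed

lemma h'_mvt:
  assumes "0 \<le> x" "x < y" "y \<le> 1"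
  obtains t where "x < t" "t < y" "h' y - h' x = h'' t * (y - x)"
proof -
  have "continuous_on {x..y} h'"
    using cont_h' by (rule continuous_on_subset) (use assms in auto)
  moreover have "h' differentiable (at t)" if "x < t" "t < y" for t
    using deriv_h'_at[of t] that assms by (auto simp: real_differentiable_def)
  ultimately obtain l z where "x < z" "z < y" "DERIV h' z :> l" "h' y - h' x = (y - x) * l"
    using MVT[of x y h'] assms by blast
  moreover have "l = h'' z"
    using DERIV_unique[OF \<open>DERIV h' z :> l\<close> deriv_h'_at[of z]] \<open>x < z\<close> \<open>z < y\<close> assms by simp
  ultimately show thesis
    using that[of z] by (simp add: mult.commute)
qed

lemma ln_h'_mvt:
  assumes "0 \<le> x" "x < y" "y \<le> 1"
  obtains t where "x < t" "t < y" "ln (h' y) - ln (h' x) = h'' t / h' t * (y - x)"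
proof -
  have "continuous_on {x..y} (\<lambda>t. ln (h' t))"
    using cont_h' h'_pos assms
    by (intro continuous_on_ln) (auto intro: continuous_on_subset simp: less_imp_neq[symmetric])
  moreover have d: "((\<lambda>t. ln (h' t)) has_real_derivative h'' t / h' t) (at t)" if "x < t" "t < y" for t
    using deriv_h'_at[of t] h'_pos[of t] that assms
    by (auto intro!: derivative_eq_intros)
  ultimately obtain l z where z: "x < z" "z < y" "DERIV (\<lambda>t. ln (h' t)) z :> l"
      "ln (h' y) - ln (h' x) = (y - x) * l"
    using MVT[of x y "\<lambda>t. ln (h' t)"] assms unfolding real_differentiable_def by blast
  moreover have "l = h'' z / h' z"
    using DERIV_unique[OF z(3) d] z by simp
  ultimately show thesis
    using that[of z] by (simp add: mult.commute)
qed

lemma q_eq_h':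
  assumes "0 \<le> x" "x \<le> y" "y \<le> 1"
  obtains t where "t \<in> {x..y}" "q x y = h' t"
proof (cases "x = y")
  case True
  then show thesis using that[of x] by (simp add: q_def)
next
  case False
  then obtain t where "x < t" "t < y" "h y - h x = h' t * (y - x)"
    using h_mvt[of x y] assms by auto
  then show thesis using that[of t] False by (simp add: q_def)
qed

lemma h_taylor2:
  assumes "0 \<le> x" "x < y" "y \<le> 1"
  obtains t where "x < t" "t < y" "h y = h x + h' x * (y - x) + h'' t / 2 * (y - x)\<^sup>2"
proof -
  \<comment> \<open>\<open>M\<close> is chosen to make \<open>G x = G y\<close>. Rolle for
    \<open>G\<close> then expresses \<open>M\<close> through an increment of \<open>h'\<close>, and
    the mean value theorem for \<open>h'\<close> turns this into \<open>h'' t / 2\<close>.\<close>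
  define M where "M = (h y - h x - h' x * (y - x)) / (y - x)\<^sup>2"
  define G where "G = (\<lambda>t. h t - h x - h' x * (t - x) - M * (t - x)\<^sup>2)"
  have "G x = G y"
    using assms by (simp add: G_def M_def)
  moreover have "continuous_on {x..y} G"
    unfolding G_def
    by (intro continuous_intros continuous_on_subset[OF cont_h]) (use assms in auto)
  moreover have d: "(G has_real_derivative h' t - h' x - 2 * M * (t - x)) (at t)" if "x < t" "t < y" for t
    unfolding G_def using assms that
    by (auto intro!: derivative_eq_intros deriv_h_at simp: algebra_simps)
  ultimately obtain z where z: "x < z" "z < y" "DERIV G z :> 0"
    using Rolle[of x y G] assms unfolding real_differentiable_def by blast
  then have "h' z - h' x = 2 * M * (z - x)"
    using DERIV_unique[OF z(3) d] z by simp
  moreover obtain t where t: "x < t" "t < z" "h' z - h' x = h'' t * (z - x)"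
    using h'_mvt[of x z] z assms by auto
  ultimately have "M = h'' t / 2"
    using z by simp
  moreover have "h y = h x + h' x * (y - x) + M * (y - x)\<^sup>2"
    using \<open>G x = G y\<close> by (simp add: G_def)
  ultimately show thesis
    using that[of t] t(1,2) z(2) by simp
qed

text \<open>First-order expansions of both logarithms at \<open>x\<close>; their leading terms cancel as
  \<open>y\<close> tends to \<open>x\<close>, since \<open>s\<close>, \<open>t\<close> and \<open>u\<close> are squeezed between them.\<close>

lemma phi_eq:
  assumes "0 \<le> x" "x < y" "y \<le> 1"
  obtains s t u where "s \<in> {x..y}" "t \<in> {x..y}" "u \<in> {x..y}"
    "phi x y = (h'' s / h' s - h'' t / h' u) / 2 * (y - x)"
proof -
  obtain s where s: "x < s" "s < y" "ln (h' y) - ln (h' x) = h'' s / h' s * (y - x)"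
    using ln_h'_mvt assms .
  obtain t where t: "x < t" "t < y" "h y = h x + h' x * (y - x) + h'' t / 2 * (y - x)\<^sup>2"
    using h_taylor2 assms .
  have qt: "q x y - h' x = h'' t / 2 * (y - x)"
    using assms by (simp add: q_def t(3) power2_eq_square field_simps)
  obtain r where r: "r \<in> {x..y}" "q x y = h' r"
    using q_eq_h'[of x y] assms by auto
  have pos: "0 < h' x" "0 < h' r"
    using h'_pos[of x] h'_pos[of r] r assms by auto
  \<comment> \<open>Mean value theorem for \<open>ln\<close> between the values \<open>h' x\<close>
    and \<open>h' r = q x y\<close>; their order is unknown, hence the closed segment and the case
    split.\<close>
  obtain z where z: "z \<in> closed_segment (h' x) (h' r)" "ln (h' r) - ln (h' x) = (h' r - h' x) / z"
  proof (cases "h' x = h' r")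
    case True
    then show thesis using that[of "h' x"] by simp
  next
    case False
    have *: "\<exists>z. a < z \<and> z < b \<and> ln b - ln a = (b - a) * (1 / z)" if "0 < a" "a < b" for a b :: real
      using that by (intro MVT2) (auto intro!: derivative_eq_intros)
    show thesis
    proof (cases "h' x < h' r")
      case True
      then show thesis
        using *[of "h' x" "h' r"] pos that by (auto simp: closed_segment_eq_real_ivl)
    next
      case False
      then obtain z where "h' r < z" "z < h' x" "ln (h' x) - ln (h' r) = (h' x - h' r) * (1 / z)"
        using *[of "h' r" "h' x"] pos \<open>h' x \<noteq> h' r\<close> by auto
      then show thesis
        using that[of z] False minus_divide_left[of "h' x - h' r" z]
        by (simp add: closed_segment_eq_real_ivl)
    qed
  qed
  \<comment> \<open>Intermediate value theorem: the point \<open>z\<close> between two values of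
    \<open>h'\<close> is itself a value \<open>h' u\<close> with \<open>u\<close> between
    \<open>x\<close> and \<open>r\<close>.\<close>
  have "continuous_on {x..r} h'"
    using cont_h' by (rule continuous_on_subset) (use assms r in auto)
  then have "closed_segment (h' x) (h' r) \<subseteq> h' ` {x..r}"
    using r connected_continuous_image[of "{x..r}" h']
    by (intro closed_segment_subset) (simp_all add: connected_convex_1)
  then obtain u where u: "u \<in> {x..r}" "z = h' u"
    using z by auto
  have qz: "ln (q x y) - ln (h' x) = (h'' t / 2 * (y - x)) / h' u"
    using z(2) by (simp only: u(2) qt flip: r(2))
  have "phi x y = (ln (h' y) - ln (h' x)) / 2 - (ln (q x y) - ln (h' x))"
    by (simp add: phi_def field_simps)
  also have "\<dots> = h'' s / h' s * (y - x) / 2 - (h'' t / 2 * (y - x)) / h' u"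
    by (simp only: s(3) qz)
  also have "\<dots> = (h'' s / h' s - h'' t / h' u) / 2 * (y - x)"
    by (simp add: left_diff_distrib right_diff_distrib diff_divide_distrib mult_ac)
  finally show thesis
    using that[of s t u] s t u r by auto
qed

text \<open>Division by zero yields 0 on the diagonal, which is precisely the limit of the quotient
  there (\<open>tendsto_psi\<close>).\<close>

definition psi :: "real \<Rightarrow> real \<Rightarrow> real" where
  "psi x y = phi x y / (y - x)"

lemma psi_eq_phi [simp]: "psi x x = 0" "(y - x) * psi x y = phi x y"
  by (auto simp: psi_def phi_def q_def)

lemma h'_lower: obtains m where "0 < m" "\<And>x. x \<in> {0..1} \<Longrightarrow> m \<le> h' x"
proof -
  obtain a where "a \<in> {0..1}" "\<forall>x\<in>{0..1}. h' a \<le> h' x"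
    using continuous_attains_inf[OF _ _ cont_h'] by auto
  then show thesis using that[of "h' a"] h'_pos by auto
qed

lemma ln_h'_bound: obtains M where "0 \<le> M" "\<And>x. x \<in> {0..1} \<Longrightarrow> \<bar>ln (h' x)\<bar> \<le> M"
proof -
  have "continuous_on {0..1} (\<lambda>x. ln (h' x))"
    using cont_h' h'_pos by (intro continuous_on_ln) (auto simp: less_imp_neq[symmetric])
  then have "bounded ((\<lambda>x. ln (h' x)) ` {0..1})"
    by (intro compact_imp_bounded compact_continuous_image) auto
  then obtain M where "\<forall>x\<in>{0..1}. \<bar>ln (h' x)\<bar> \<le> M"
    by (auto simp: bounded_iff)
  then show thesis using that[of M] by (force intro: order_trans[OF abs_ge_zero])
qed

text \<open>By \<open>phi_eq\<close>, the supremum of \<open>\<bar>h''\<bar>\<close> divided by the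
  infimum of \<open>h'\<close> is a bound.\<close>

lemma psi_bound: obtains L where "0 \<le> L" "\<And>x y. 0 \<le> x \<Longrightarrow> x \<le> y \<Longrightarrow> y \<le> 1 \<Longrightarrow> \<bar>psi x y\<bar> \<le> L"
proof -
  obtain m where m: "0 < m" "\<And>x. x \<in> {0..1} \<Longrightarrow> m \<le> h' x"
    using h'_lower by blast
  have "bounded (h'' ` {0..1})"
    using cont_h'' by (intro compact_imp_bounded compact_continuous_image) auto
  then obtain K where K: "\<And>x. x \<in> {0..1} \<Longrightarrow> \<bar>h'' x\<bar> \<le> K"
    unfolding bounded_iff by (metis imageI real_norm_def)
  have K0: "0 \<le> K" using K[of 0] by auto
  have b: "\<bar>h'' s / h' t\<bar> \<le> K / m" if "s \<in> {0..1}" "t \<in> {0..1}" for s t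
    using K[OF that(1)] m(2)[OF that(2)] m(1) K0 by (auto simp: abs_div intro!: frac_le)
  have "\<bar>psi x y\<bar> \<le> K / m" if "0 \<le> x" "x \<le> y" "y \<le> 1" for x y
  proof (cases "x = y")
    case True
    then show ?thesis using K0 m by simp
  next
    case False
    then have "x < y" using \<open>x \<le> y\<close> by simp
    then obtain s t u where *: "s \<in> {x..y}" "t \<in> {x..y}" "u \<in> {x..y}"
        "phi x y = (h'' s / h' s - h'' t / h' u) / 2 * (y - x)"
      using phi_eq[of x y] \<open>0 \<le> x\<close> \<open>y \<le> 1\<close> by blast
    from *(4) have "psi x y = (h'' s / h' s - h'' t / h' u) / 2"
      using False by (simp add: psi_def)
    moreover have "\<bar>h'' s / h' s\<bar> \<le> K / m" "\<bar>h'' t / h' u\<bar> \<le> K / m"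
      by (rule b; use * that in auto)+
    moreover have "\<bar>(A - B) / 2\<bar> \<le> c" if "\<bar>A\<bar> \<le> c" "\<bar>B\<bar> \<le> c" for A B c :: real
      using that by (auto simp: abs_le_iff)
    ultimately show ?thesis by metis
  qed
  then show thesis using that[of "K / m"] K0 m by auto
qed

text \<open>Off the diagonal this is continuity of \<open>h\<close>; on it, \<open>q\<close> is a
  value of \<open>h'\<close> at a mean value point squeezed between the two sequences.\<close>

lemma tendsto_q:
  assumes X: "X \<longlonglongrightarrow> x" and Y: "Y \<longlonglongrightarrow> y"
    and XY: "\<And>n. 0 \<le> X n" "\<And>n. X n \<le> Y n" "\<And>n. Y n \<le> 1"
  shows "(\<lambda>n. q (X n) (Y n)) \<longlonglongrightarrow> q x y"
proof (cases "x = y")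
  case False
  have "(\<lambda>n. Y n - X n) \<longlonglongrightarrow> y - x"
    by (intro tendsto_intros X Y)
  then have "\<forall>\<^sub>F n in sequentially. Y n - X n \<noteq> 0"
    by (rule tendsto_imp_eventually_ne) (use False in auto)
  then have "\<forall>\<^sub>F n in sequentially. (h (Y n) - h (X n)) / (Y n - X n) = q (X n) (Y n)"
    by eventually_elim (auto simp: q_def)
  moreover have "(\<lambda>n. (h (Y n) - h (X n)) / (Y n - X n)) \<longlonglongrightarrow> (h y - h x) / (y - x)"
    using False XY by (intro tendsto_intros tendsto_within_01[OF cont_h] X Y)
      (auto intro: order_trans)
  ultimately show ?thesis
    using False by (simp add: q_def tendsto_cong)
next
  case True
  have "\<exists>t. t \<in> {X n..Y n} \<and> q (X n) (Y n) = h' t" for n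
    using q_eq_h' XY by metis
  then obtain T where T: "\<And>n. T n \<in> {X n..Y n}" "\<And>n. q (X n) (Y n) = h' (T n)"
    by metis
  have "T \<longlonglongrightarrow> x"
    using T X Y True by (intro tendsto_sandwich[of X T _ Y]) auto
  then have "(\<lambda>n. h' (T n)) \<longlonglongrightarrow> h' x"
  proof (rule tendsto_within_01[OF cont_h'])
    show "T n \<in> {0..1}" for n
      using T(1)[of n] XY(1,3)[of n] by auto
  qed
  then show ?thesis using True T by (simp add: q_def)
qed

lemma q_pos: "0 \<le> x \<Longrightarrow> x \<le> y \<Longrightarrow> y \<le> 1 \<Longrightarrow> 0 < q x y"
  using q_eq_h'[of x y] h'_pos by (metis atLeastAtMost_iff order_trans)

text \<open>Only the diagonal needs an argument: the three intermediate points of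
  \<open>phi_eq\<close> converge to the common limit \<open>x\<close>, so the two quotients
  \<open>h'' / h'\<close> cancel.\<close>

lemma tendsto_psi:
  assumes X: "X \<longlonglongrightarrow> x" and Y: "Y \<longlonglongrightarrow> y"
    and XY: "\<And>n. 0 \<le> X n" "\<And>n. X n \<le> Y n" "\<And>n. Y n \<le> 1"
  shows "(\<lambda>n. psi (X n) (Y n)) \<longlonglongrightarrow> psi x y"
proof (cases "x = y")
  case False
  have X01: "X n \<in> {0..1}" and Y01: "Y n \<in> {0..1}" for n
    using XY(1,2,3)[of n] by auto
  have xy01: "x \<in> {0..1}" "y \<in> {0..1}"
    using X01 Y01 X Y lim_in_01 by blast+
  have "x \<le> y" using X Y XY by (intro LIMSEQ_le) auto
  show ?thesis
    unfolding psi_def phi_def using False h'_pos[of x] h'_pos[of y] q_pos[of x y] xy01 \<open>x \<le> y\<close>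
    by (intro tendsto_divide tendsto_diff tendsto_add tendsto_ln tendsto_const
          tendsto_q X Y XY tendsto_within_01[OF cont_h'] X01 Y01) auto
next
  case True
  have "\<exists>s t u. s \<in> {X n..Y n} \<and> t \<in> {X n..Y n} \<and> u \<in> {X n..Y n} \<and>
     psi (X n) (Y n) = (h'' s / h' s - h'' t / h' u) / 2" for n
  proof (cases "X n = Y n")
    case True
    then show ?thesis by auto
  next
    case False
    then have "X n < Y n" using XY(2)[of n] by simp
    then show ?thesis
      using phi_eq[OF XY(1) _ XY(3), of n] False
      by (smt (verit, ccfv_threshold) nonzero_mult_div_cancel_right psi_def)
  qed
  then obtain S T U where STU: "\<And>n. S n \<in> {X n..Y n}" "\<And>n. T n \<in> {X n..Y n}" "\<And>n. U n \<in> {X n..Y n}"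
     "\<And>n. psi (X n) (Y n) = (h'' (S n) / h' (S n) - h'' (T n) / h' (U n)) / 2"
    by metis
  have lim: "Z \<longlonglongrightarrow> x" and in01: "\<And>n. Z n \<in> {0..1}" if "\<And>n. Z n \<in> {X n..Y n}" for Z
  proof -
    show "Z \<longlonglongrightarrow> x"
      using that X Y True by (intro tendsto_sandwich[of X Z _ Y]) auto
    show "Z n \<in> {0..1}" for n
      using that[of n] XY(1,3)[of n] by auto
  qed
  have "x \<in> {0..1}"
    using lim[of S] in01[of S] STU lim_in_01 by blast
  then have "h' x \<noteq> 0" using h'_pos[of x] by auto
  then have "(\<lambda>n. (h'' (S n) / h' (S n) - h'' (T n) / h' (U n)) / 2) \<longlonglongrightarrow> (h'' x / h' x - h'' x / h' x) / 2"
    using STU by (intro tendsto_intros tendsto_within_01[OF cont_h'] tendsto_within_01[OF cont_h''] lim in01) auto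
  then show ?thesis using True by (simp flip: STU(4))
qed

lemma h_le_iff: "x \<in> {0..1} \<Longrightarrow> y \<in> {0..1} \<Longrightarrow> h x \<le> h y \<longleftrightarrow> x \<le> y"
  and h_less_iff: "x \<in> {0..1} \<Longrightarrow> y \<in> {0..1} \<Longrightarrow> h x < h y \<longleftrightarrow> x < y"
  using h_mono by (auto simp: strict_mono_on_leD strict_mono_on_less strict_mono_on_less_eq)

lemma ln_q_bound: obtains M where "0 \<le> M" "\<And>x y. 0 \<le> x \<Longrightarrow> x \<le> y \<Longrightarrow> y \<le> 1 \<Longrightarrow> \<bar>ln (q x y)\<bar> \<le> M"
proof -
  obtain M where M: "0 \<le> M" "\<And>x. x \<in> {0..1} \<Longrightarrow> \<bar>ln (h' x)\<bar> \<le> M"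
    using ln_h'_bound by blast
  have "\<bar>ln (q x y)\<bar> \<le> M" if "0 \<le> x" "x \<le> y" "y \<le> 1" for x y
    using q_eq_h'[OF that] M(2) that by (metis atLeastAtMost_iff order_trans)
  then show thesis using that[of M] M by blast
qed

end

section \<open>Right continuous monotone paths\<close>

lemma G0_outside: "g \<in> G0 \<Longrightarrow> t < 0 \<or> 1 \<le> t \<Longrightarrow> g t = 1"
  by (auto simp: G0_def)

lemma G0_range: "g \<in> G0 \<Longrightarrow> 0 \<le> g t \<and> g t \<le> 1"
  by (cases "t \<in> {0..<1}") (auto simp: G0_def)

text \<open>The default value 1 extends monotonicity to all of the half-line from 0 on; it fails
  across 0, since paths equal 1 at negative arguments.\<close>

lemma G0_mono: "g \<in> G0 \<Longrightarrow> 0 \<le> s \<Longrightarrow> s \<le> t \<Longrightarrow> g s \<le> g t"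
proof (cases "t < 1")
  case True
  assume "g \<in> G0" "0 \<le> s" "s \<le> t"
  with True show ?thesis by (auto simp: G0_def elim!: mono_onD)
next
  case False
  assume "g \<in> G0" "0 \<le> s" "s \<le> t"
  with False G0_range[of g s] G0_outside[of g t] show ?thesis by simp
qed

lemma G0_right_cont: 
  assumes "g \<in> G0" "0 \<le> t"
  shows "(g \<longlongrightarrow> g t) (at_right t)"
proof (cases "t < 1")
  case True
  then show ?thesis using assms by (auto simp: G0_def continuous_within)
next
  case False
  then have "\<forall>\<^sub>F s in at_right t. g s = g t"
    using assms by (auto simp: eventually_at_filter G0_outside)
  then show ?thesis by (simp add: tendsto_eventually)
qed

text \<open>\<open>left_lim\<close> is given by \<open>Lim\<close>, which says nothing until a limit
  is exhibited. The supremum of \<open>g\<close> over \<open>{0..<a}\<close> is that limit, and the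
  second and fourth claims record that it is the least upper bound.\<close>

lemma G0_left_lim:
  assumes g: "g \<in> G0" and a: "0 < a"
  shows "(g \<longlongrightarrow> left_lim g a) (at_left a)"
    and "\<And>t. 0 \<le> t \<Longrightarrow> t < a \<Longrightarrow> g t \<le> left_lim g a"
    and "left_lim g a \<le> g a"
    and "\<And>x. (\<And>t. 0 \<le> t \<Longrightarrow> t < a \<Longrightarrow> g t \<le> x) \<Longrightarrow> left_lim g a \<le> x"
proof -
  define l where "l = Sup (g ` {0..<a})"
  have bdd: "bdd_above (g ` {0..<a})" and ne: "g ` {0..<a} \<noteq> {}"
    using G0_range[OF g] a by (auto intro!: bdd_aboveI[of _ 1])
  have up: "g t \<le> l" if "0 \<le> t" "t < a" for t
    unfolding l_def using that by (intro cSup_upper bdd) auto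
  have least: "l \<le> x" if "\<And>t. 0 \<le> t \<Longrightarrow> t < a \<Longrightarrow> g t \<le> x" for x
    unfolding l_def using that by (intro cSup_least ne) auto
  have "(g \<longlongrightarrow> l) (at_left a)"
  proof (rule order_tendstoI)
    fix y assume "y < l"
    then obtain t where t: "0 \<le> t" "t < a" "y < g t"
      using least[of y] by (meson not_le)
    have "\<forall>\<^sub>F s in at_left a. t < s \<and> s < a"
      using eventually_at_left_real[OF t(2)] by simp
    then show "\<forall>\<^sub>F s in at_left a. y < g s"
      by eventually_elim (meson t G0_mono[OF g] less_le_trans less_imp_le)
  next
    fix y assume "l < y"
    have "\<forall>\<^sub>F s in at_left a. 0 < s \<and> s < a"
      using eventually_at_left_real[OF a] by simp
    then show "\<forall>\<^sub>F s in at_left a. g s < y"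
      by eventually_elim (meson up \<open>l < y\<close> le_less_trans less_imp_le)
  qed
  then have l: "left_lim g a = l"
    unfolding left_lim_def by (intro tendsto_Lim) auto
  show "(g \<longlongrightarrow> left_lim g a) (at_left a)"
    unfolding l by fact
  show "\<And>t. 0 \<le> t \<Longrightarrow> t < a \<Longrightarrow> g t \<le> left_lim g a"
    unfolding l by (rule up)
  show "\<And>x. (\<And>t. 0 \<le> t \<Longrightarrow> t < a \<Longrightarrow> g t \<le> x) \<Longrightarrow> left_lim g a \<le> x"
    unfolding l by (rule least)
  show "left_lim g a \<le> g a"
    unfolding l by (rule least) (simp add: G0_mono[OF g])
qed

lemma left_lim_range:
  assumes "g \<in> G0" "0 < a"
  shows "0 \<le> left_lim g a" "left_lim g a \<le> 1"
  using G0_left_lim(2)[OF assms, of 0] G0_left_lim(3)[OF assms] G0_range[OF assms(1)] assms(2)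
  by (meson order_trans order_refl)+

text \<open>These are the two ends of the grid cell, open on the left and closed on the right, that
  contains \<open>s\<close>. The right end is at least \<open>s\<close> and the left end is strictly
  below it, so along a path they yield the value and the left limit at \<open>s\<close>.\<close>

lemma ceiling_grid_tendsto: "(\<lambda>n. real_of_int \<lceil>real n * s\<rceil> / real n) \<longlonglongrightarrow> s"
  and ceiling_grid_tendsto': "(\<lambda>n. (real_of_int \<lceil>real n * s\<rceil> - 1) / real n) \<longlonglongrightarrow> s"
proof -
  have lim: "(\<lambda>n. s + 1 / real n) \<longlonglongrightarrow> s" "(\<lambda>n. s - 1 / real n) \<longlonglongrightarrow> s"
    using tendsto_add[OF tendsto_const lim_1_over_n, of s] tendsto_diff[OF tendsto_const lim_1_over_n, of s]
    by simp_all
  have b: "s \<le> real_of_int \<lceil>real n * s\<rceil> / real n"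
      "real_of_int \<lceil>real n * s\<rceil> / real n \<le> s + 1 / real n"
      "s - 1 / real n \<le> (real_of_int \<lceil>real n * s\<rceil> - 1) / real n"
      "(real_of_int \<lceil>real n * s\<rceil> - 1) / real n \<le> s" if "n > 0" for n
    using that ceiling_correct[of "real n * s"] by (auto simp: field_simps)
  have ev: "\<forall>\<^sub>F n in sequentially. (0::nat) < n"
    by (rule eventually_gt_at_top)
  show "(\<lambda>n. real_of_int \<lceil>real n * s\<rceil> / real n) \<longlonglongrightarrow> s"
    by (rule tendsto_sandwich[OF _ _ tendsto_const lim(1)]; rule eventually_mono[OF ev]) (use b in auto)
  show "(\<lambda>n. (real_of_int \<lceil>real n * s\<rceil> - 1) / real n) \<longlonglongrightarrow> s"
    by (rule tendsto_sandwich[OF _ _ lim(2) tendsto_const]; rule eventually_mono[OF ev]) (use b in auto)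
qed

lemma G0_ceiling_grid:
  assumes "g \<in> G0" "0 \<le> s"
  shows "(\<lambda>n. g (real_of_int \<lceil>real n * s\<rceil> / real n)) \<longlonglongrightarrow> g s"
proof -
  have "continuous (at s within {s..}) g"
    using G0_right_cont[OF assms] by (simp add: continuous_within at_within_Ici_at_right)
  moreover have "\<forall>\<^sub>F n in sequentially. real_of_int \<lceil>real n * s\<rceil> / real n \<in> {s..}"
    using eventually_gt_at_top[of "0::nat"]
    by eventually_elim (use ceiling_correct in \<open>auto simp: field_simps\<close>)
  ultimately show ?thesis
    using ceiling_grid_tendsto[of s] by (rule continuous_within_tendsto_compose)
qed

lemma G0_ceiling_grid_left:
  assumes "g \<in> G0" "0 < s"
  shows "(\<lambda>n. g ((real_of_int \<lceil>real n * s\<rceil> - 1) / real n)) \<longlonglongrightarrow> left_lim g s"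
proof (rule filterlim_compose[OF G0_left_lim(1)[OF assms]])
  have "\<forall>\<^sub>F n in sequentially. (real_of_int \<lceil>real n * s\<rceil> - 1) / real n \<in> {..<s} - {s}"
    using eventually_gt_at_top[of "0::nat"]
  proof eventually_elim
    case (elim n)
    then show ?case using ceiling_correct[of "real n * s"] by (auto simp: field_simps)
  qed
  then show "filterlim (\<lambda>n. (real_of_int \<lceil>real n * s\<rceil> - 1) / real n) (at_left s) sequentially"
    using ceiling_grid_tendsto'[of s] by (auto simp: filterlim_at elim: eventually_mono)
qed

section \<open>Step functions over an increasing partition\<close>

lemma step_sum:
  fixes u c :: "nat \<Rightarrow> real"
  assumes mono: "\<And>i j. i \<le> j \<Longrightarrow> j \<le> n \<Longrightarrow> u i \<le> u j"
    and "j < n" "x \<in> {u j<..u (Suc j)}"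
  shows "(\<Sum>i<n. indicator {u i<..u (Suc i)} x * c i) = c j"
proof -
  have "x \<notin> {u i<..u (Suc i)}" if "i < n" "i \<noteq> j" for i
  proof (cases "i < j")
    case True
    then show ?thesis using mono[of "Suc i" j] assms(2,3) by (simp add: Suc_le_eq)
  next
    case False
    then show ?thesis using mono[of "Suc j" i] assms(2,3) that by (simp add: Suc_le_eq)
  qed
  then have "(\<Sum>i<n. indicator {u i<..u (Suc i)} x * c i) = (\<Sum>i<n. if i = j then c j else 0)"
    using assms by (intro sum.cong) (auto simp: indicator_def)
  also have "\<dots> = c j"
    using assms by (simp add: sum.delta)
  finally show ?thesis .
qed

text \<open>Provides the integrable majorant for both dominated convergence arguments on the
  line.\<close>

lemma step_sum_abs_le:
  fixes u c :: "nat \<Rightarrow> real"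
  assumes mono: "\<And>i j. i \<le> j \<Longrightarrow> j \<le> n \<Longrightarrow> u i \<le> u j"
    and c: "\<And>i. i < n \<Longrightarrow> \<bar>c i\<bar> \<le> L" and "0 \<le> L" and u: "0 \<le> u 0" "u n \<le> 1"
  shows "\<bar>\<Sum>i<n. indicator {u i<..u (Suc i)} x * c i\<bar> \<le> indicator {0..1} x * L"
proof (cases "\<exists>j<n. x \<in> {u j<..u (Suc j)}")
  case True
  then obtain j where j: "j < n" "x \<in> {u j<..u (Suc j)}" by blast
  then have "x \<in> {0..1}"
    using mono[of 0 j] mono[of "Suc j" n] u by auto
  then show ?thesis
    using step_sum[of n u j x c] c mono j by simp
next
  case False
  then have "(\<Sum>i<n. indicator {u i<..u (Suc i)} x * c i) = 0"
    by (intro sum.neutral) (auto simp: indicator_def)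
  then show ?thesis using \<open>0 \<le> L\<close> by simp
qed

lemma integral_step_sum:
  fixes u c :: "nat \<Rightarrow> real"
  assumes "\<And>i. i < n \<Longrightarrow> u i \<le> u (Suc i)"
  shows "(LINT x|lborel. (\<Sum>i<n. indicator {u i<..u (Suc i)} x * c i)) = (\<Sum>i<n. (u (Suc i) - u i) * c i)"
proof -
  have "(LINT x|lborel. (\<Sum>i<n. indicator {u i<..u (Suc i)} x * c i)) =
      (\<Sum>i<n. LINT x|lborel. indicator {u i<..u (Suc i)} x * c i)"
    using assms by (intro Bochner_Integration.integral_sum integrable_mult_left) 
      (auto intro!: integrable_real_indicator)
  also have "\<dots> = (\<Sum>i<n. (u (Suc i) - u i) * c i)"
    using assms by (intro sum.cong) auto
  finally show ?thesis .
qed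

lemma ceiling_grid_index:
  assumes "0 < s" "s < 1" "0 < n"
  obtains j where "j < n" "real_of_int \<lceil>real n * s\<rceil> = real (Suc j)"
    "real j / real n < s" "s \<le> real (Suc j) / real n"
proof -
  have "0 < \<lceil>real n * s\<rceil>" "\<lceil>real n * s\<rceil> \<le> int n"
    using assms by (auto simp: ceiling_le_iff mult_le_cancel_left1)
  then obtain j where j: "\<lceil>real n * s\<rceil> = int (Suc j)" "j < n"
    by (metis Suc_le_eq not0_implies_Suc of_nat_0 of_nat_le_iff less_irrefl zero_less_imp_eq_int)
  then show thesis
    using that[of j] ceiling_correct[of "real n * s"] assms by (auto simp: field_simps)
qed

section \<open>Jump intervals and quantiles of a path\<close>

lemma G0_jump_interval_disjoint:
  assumes "g \<in> G0" "0 < a" "0 < b" "a \<noteq> b"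
  shows "{left_lim g a<..g a} \<inter> {left_lim g b<..g b} = {}"
  using G0_left_lim(2)[OF assms(1,2), of b] G0_left_lim(2)[OF assms(1,3), of a] assms(2-)
  by (cases "a < b") auto

text \<open>The jump intervals are disjoint subsets of \<open>{0..1}\<close>, and their lengths are
  the jump heights; compare Lebesgue measures.\<close>

lemma G0_sum_jumps_le:
  assumes g: "g \<in> G0" and F: "finite F" "F \<subseteq> {0<..}"
  shows "(\<Sum>a\<in>F. g a - left_lim g a) \<le> 1"
proof -
  have "disjoint_family_on (\<lambda>a. {left_lim g a<..g a}) F"
    using G0_jump_interval_disjoint[OF g] F by (auto simp: disjoint_family_on_def)
  then have "(\<Sum>a\<in>F. measure lborel {left_lim g a<..g a}) = measure lborel (\<Union>a\<in>F. {left_lim g a<..g a})"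
    using F by (intro measure_finite_Union[symmetric])
      (auto simp: emeasure_lborel_Ioc[OF G0_left_lim(3)[OF g]] subset_iff)
  also have "\<dots> \<le> measure lborel {0..1::real}"
  proof (rule measure_mono_fmeasurable)
    have "{left_lim g a<..g a} \<subseteq> {0..1}" if "a \<in> F" for a
      using left_lim_range(1)[OF g, of a] G0_range[OF g, of a] that F by auto
    then show "(\<Union>a\<in>F. {left_lim g a<..g a}) \<subseteq> {0..1}" by blast
    show "(\<Union>a\<in>F. {left_lim g a<..g a}) \<in> sets lborel" using F by auto
  qed (simp add: fmeasurable_def)
  also have "(\<Sum>a\<in>F. measure lborel {left_lim g a<..g a}) = (\<Sum>a\<in>F. g a - left_lim g a)"
    using F G0_left_lim(3)[OF g] by (intro sum.cong) auto
  finally show ?thesis by simp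
qed

lemma G0_jumps_summable:
  assumes "g \<in> G0"
  shows "(\<lambda>a. g a - left_lim g a) summable_on jumps g"
    "(\<Sum>\<^sub>\<infinity>a\<in>jumps g. g a - left_lim g a) \<le> 1"
proof -
  have le: "(\<Sum>a\<in>F. g a - left_lim g a) \<le> 1" if "finite F" "F \<subseteq> jumps g" for F
    using that by (intro G0_sum_jumps_le assms) (auto simp: jumps_def)
  show *: "(\<lambda>a. g a - left_lim g a) summable_on jumps g"
  proof (rule nonneg_bdd_above_summable_on)
    show "0 \<le> g a - left_lim g a" if "a \<in> jumps g" for a
      using that G0_left_lim(3)[OF assms] by (auto simp: jumps_def)
    show "bdd_above (sum (\<lambda>a. g a - left_lim g a) ` {F. F \<subseteq> jumps g \<and> finite F})"
      using le by (auto intro!: bdd_aboveI[of _ 1])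
  qed
  then show "(\<Sum>\<^sub>\<infinity>a\<in>jumps g. g a - left_lim g a) \<le> 1"
    using le by (rule infsum_le_finite_sums)
qed

lemma countable_jumps:
  assumes "g \<in> G0"
  shows "countable (jumps g)"
proof -
  have "{a \<in> jumps g. g a - left_lim g a \<noteq> 0} = jumps g"
    by (auto simp: jumps_def)
  then show ?thesis
    using summable_countable_real[OF G0_jumps_summable(1)[OF assms]] by simp
qed

text \<open>The generalized inverse \<open>a = Inf {t. 0 \<le> t \<and> x \<le> g t}\<close>: the
  time at which \<open>g\<close> crosses level \<open>x\<close>. The assumption on the supremum
  places it below 1, right continuity gives \<open>x \<le> g a\<close>, and then
  \<open>g 0 = 0\<close> forces \<open>0 < a\<close>.\<close>

lemma G0_quantile:
  assumes g: "g \<in> G0" "g 0 = 0" and sup: "\<And>y. y < 1 \<Longrightarrow> \<exists>t. 0 \<le> t \<and> t < 1 \<and> y < g t"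
    and x: "0 < x" "x < 1"
  obtains a where "0 < a" "a < 1" "x \<le> g a" "\<And>t. 0 \<le> t \<Longrightarrow> t < a \<Longrightarrow> g t < x"
proof -
  define S where "S = {t. 0 \<le> t \<and> x \<le> g t}"
  define a where "a = Inf S"
  obtain t where t: "0 \<le> t" "t < 1" "x < g t" using sup[OF x(2)] by blast
  have bdd: "bdd_below S" by (auto simp: S_def intro!: bdd_belowI[of _ 0])
  have "a \<le> t" unfolding a_def using t by (intro cInf_lower bdd) (auto simp: S_def)
  have "0 \<le> a" unfolding a_def using t by (intro cInf_greatest) (auto simp: S_def intro: less_imp_le)
  have less: "g s < x" if "0 \<le> s" "s < a" for s
    using that cInf_lower[OF _ bdd, of s] unfolding a_def[symmetric]
    by (auto simp: S_def not_le[symmetric])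
  have gt: "x \<le> g s" if "a < s" for s
  proof -
    have "\<exists>r\<in>S. r < s"
      using that t cInf_lessD[of S s] by (auto simp: a_def S_def intro: less_imp_le)
    then obtain r where r: "0 \<le> r" "x \<le> g r" "r < s" by (auto simp: S_def)
    then show ?thesis
      using G0_mono[OF g(1), of r s] by simp
  qed
  have "x \<le> g a"
  proof (rule tendsto_lowerbound[OF G0_right_cont[OF g(1) \<open>0 \<le> a\<close>]])
    show "\<forall>\<^sub>F s in at_right a. x \<le> g s"
      using gt by (simp add: eventually_at_filter)
  qed simp
  moreover have "a \<noteq> 0" using calculation g(2) x by auto
  ultimately show thesis
    using that[of a] less \<open>0 \<le> a\<close> \<open>a \<le> t\<close> t by auto
qed

lemma measurable_G0_path:
  assumes "g \<in> G0" "continuous_on {0..1} f"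
  shows "(\<lambda>s. indicator {0..1} s * (f (g s) :: real)) \<in> borel_measurable borel"
proof -
  \<comment> \<open>Replacing the default 1 by 0 on the negative axis makes the path monotone on the
    whole line, hence Borel.\<close>
  have "mono (\<lambda>s. if s < 0 then 0 else g s)"
    using G0_mono[OF assms(1)] G0_range[OF assms(1)] by (intro monoI) auto
  then have [measurable]: "(\<lambda>s. if s < 0 then 0 else g s) \<in> borel_measurable borel"
    by (rule borel_measurable_mono)
  have "continuous_on UNIV (\<lambda>x. f (max 0 (min 1 x)))"
    by (intro continuous_on_compose2[OF assms(2)] continuous_intros) auto
  then have [measurable]: "(\<lambda>x. f (max 0 (min 1 x))) \<in> borel_measurable borel"
    by (rule borel_measurable_continuous_onI)
  have "(\<lambda>s. indicator {0..1} s * (f (g s) :: real)) =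
      (\<lambda>s. indicator {0..1} s * f (max 0 (min 1 (if s < 0 then 0 else g s))))"
    using G0_range[OF assms(1)] by (auto simp: fun_eq_iff indicator_def)
  also have "\<dots> \<in> borel_measurable borel" by measurable
  finally show ?thesis .
qed

section \<open>Limits of the grid sums\<close>

text \<open>\<open>F\<close> takes the value \<open>w a\<close> on the jump interval of
  \<open>a\<close> and 0 off these intervals. It will be the pointwise limit of the step functions
  behind \<open>Phi_grid\<close>, with \<open>w a\<close> the value of \<open>psi\<close> at the
  jump.\<close>

lemma G0_jump_sum_integral:
  assumes g: "g \<in> G0" and w: "\<And>a. a \<in> jumps g \<Longrightarrow> \<bar>w a\<bar> \<le> (L::real)"
  obtains F where "F \<in> borel_measurable borel"
    "\<And>a x. a \<in> jumps g \<Longrightarrow> x \<in> {left_lim g a<..g a} \<Longrightarrow> F x = w a"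
    "\<And>x. (\<And>a. a \<in> jumps g \<Longrightarrow> x \<notin> {left_lim g a<..g a}) \<Longrightarrow> F x = 0"
    "(LINT x|lborel. F x) = (\<Sum>\<^sub>\<infinity>a\<in>jumps g. (g a - left_lim g a) * w a)"
proof -
  define J where "J = jumps g"
  have cJ: "countable J" using countable_jumps[OF g] by (simp add: J_def)
  have J0: "0 < a" "left_lim g a \<le> g a" if "a \<in> J" for a
    using that G0_left_lim(3)[OF g] by (auto simp: J_def jumps_def)
  \<comment> \<open>There may be only finitely many jumps, so the enumeration runs over an index set
    \<open>N\<close> of naturals and is padded with zeros outside it.\<close>
  define N where "N = to_nat_on J ` J"
  define e where "e = from_nat_into J"
  have e: "bij_betw e N J"
    unfolding e_def N_def using cJ by (intro bij_betw_byWitness[where f' = "to_nat_on J"]) auto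
  have eN: "e i \<in> J" if "i \<in> N" for i
    using e that by (auto simp: bij_betw_def)
  define f where "f = (\<lambda>i x. if i \<in> N then indicator {left_lim g (e i)<..g (e i)} x * w (e i) else 0)"
  have f_eq: "f i x = (if i = to_nat_on J a then w a else 0)"
    if a: "a \<in> J" "x \<in> {left_lim g a<..g a}" for a x i
  proof (cases "i \<in> N")
    case True
    show ?thesis
    proof (cases "e i = a")
      case True
      then have "i = to_nat_on J a"
        using \<open>i \<in> N\<close> cJ by (auto simp: e_def N_def)
      then show ?thesis using a True \<open>i \<in> N\<close> by (simp add: f_def)
    next
      case False
      then have "x \<notin> {left_lim g (e i)<..g (e i)}"
        using G0_jump_interval_disjoint[OF g J0(1)[OF eN[OF True]] J0(1)[OF a(1)]] a(2) by blast
      moreover have "i \<noteq> to_nat_on J a"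
        using False a cJ by (auto simp: e_def)
      ultimately show ?thesis by (simp add: f_def)
    qed
  next
    case False
    then show ?thesis using a by (auto simp: f_def N_def)
  qed
  have f_0: "f i x = 0" if "\<And>a. a \<in> J \<Longrightarrow> x \<notin> {left_lim g a<..g a}" for x i
    using that eN by (auto simp: f_def indicator_def)
  \<comment> \<open>By disjointness at most one term is nonzero at each point, so the series
    converges pointwise for trivial reasons.\<close>
  have fin: "finite {i. f i x \<noteq> 0}" for x
  proof (cases "\<exists>a\<in>J. x \<in> {left_lim g a<..g a}")
    case True
    then obtain a where "a \<in> J" "x \<in> {left_lim g a<..g a}" by blast
    then have "{i. f i x \<noteq> 0} \<subseteq> {to_nat_on J a}" using f_eq[of a x] by auto
    then show ?thesis by (rule finite_subset) simp
  next
    case False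
    then show ?thesis using f_0[of x] by auto
  qed
  have sums_N: "(\<lambda>i. if i \<in> N then t (e i) else 0) sums infsum t J" if "t summable_on J" for t :: "real \<Rightarrow> real"
  proof -
    have "((\<lambda>i. t (e i)) has_sum infsum t J) N"
      using has_sum_reindex_bij_betw[OF e, of t] that by (simp add: has_sum_infsum)
    also have "?this \<longleftrightarrow> ((\<lambda>i. if i \<in> N then t (e i) else 0) has_sum infsum t J) UNIV"
      by (rule has_sum_cong_neutral) auto
    finally show ?thesis by (rule has_sum_imp_sums)
  qed
  define t where "t = (\<lambda>a. (g a - left_lim g a) * w a)"
  have "(\<lambda>a. L * (g a - left_lim g a)) summable_on J"
    using G0_jumps_summable(1)[OF g] unfolding J_def by (rule summable_on_cmult_right)
  then have abs_t: "(\<lambda>a. \<bar>t a\<bar>) summable_on J"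
    by (rule summable_on_comparison_test)
      (use J0 w in \<open>auto simp: t_def J_def abs_mult mult.commute[of L] intro!: mult_left_mono\<close>)
  then have t: "t summable_on J"
    using abs_summable_summable[of t J] by simp
  have int: "integrable lborel (f i)" "(LINT x|lborel. f i x) = (if i \<in> N then t (e i) else 0)"
    "(LINT x|lborel. norm (f i x)) = (if i \<in> N then \<bar>t (e i)\<bar> else 0)" for i
  proof -
    have le: "left_lim g (e i) \<le> g (e i)" if "i \<in> N" using J0(2) eN that by blast
    show "integrable lborel (f i)"
      by (cases "i \<in> N") (auto simp: f_def le intro!: integrable_mult_left integrable_real_indicator)
    show "(LINT x|lborel. f i x) = (if i \<in> N then t (e i) else 0)"
      by (auto simp: f_def t_def le)
    have "norm (f i x) = (if i \<in> N then indicator {left_lim g (e i)<..g (e i)} x * \<bar>w (e i)\<bar> else 0)" for x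
      by (auto simp: f_def abs_mult)
    then show "(LINT x|lborel. norm (f i x)) = (if i \<in> N then \<bar>t (e i)\<bar> else 0)"
      by (auto simp: t_def le abs_mult)
  qed
  have summ: "summable (\<lambda>i. LINT x|lborel. norm (f i x))"
    unfolding int(3) using sums_N[OF abs_t] by (rule sums_summable)
  have ae: "AE x in lborel. summable (\<lambda>i. norm (f i x))"
  proof (rule AE_I2)
    fix x
    show "summable (\<lambda>i. norm (f i x))"
      using fin[of x] by (rule summable_finite) simp
  qed
  have "(\<lambda>i. LINT x|lborel. f i x) sums (LINT x|lborel. (\<Sum>i. f i x))"
    using int(1) ae summ by (rule sums_integral)
  then have eq: "(LINT x|lborel. (\<Sum>i. f i x)) = infsum t J"
    using sums_N[OF t] unfolding int(2) by (rule sums_unique2)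
  show thesis
  proof (rule that[of "\<lambda>x. \<Sum>i. f i x"])
    have [measurable]: "f i \<in> borel_measurable borel" for i
      using int(1)[of i] by (simp add: integrable_iff_bounded)
    show "(\<lambda>x. \<Sum>i. f i x) \<in> borel_measurable borel" by measurable
    show "(\<Sum>i. f i x) = w a" if "a \<in> jumps g" "x \<in> {left_lim g a<..g a}" for a x
      using that f_eq[of a x] suminf_finite[of "{to_nat_on J a}" "\<lambda>i. f i x"] by (simp add: J_def)
    show "(\<Sum>i. f i x) = 0" if "\<And>a. a \<in> jumps g \<Longrightarrow> x \<notin> {left_lim g a<..g a}" for x
      using that f_0[of x] by (simp add: J_def)
    show "(LINT x|lborel. (\<Sum>i. f i x)) = (\<Sum>\<^sub>\<infinity>a\<in>jumps g. (g a - left_lim g a) * w a)"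
      using eq by (simp add: t_def J_def)
  qed
qed

context C2_iso01
begin

lemma ln_jump_factor:
  assumes "g \<in> G0" "a \<in> jumps g"
  shows "ln (jump_factor h h' g a) = phi (left_lim g a) (g a)"
proof -
  have a: "0 < a" "left_lim g a \<noteq> g a" using assms by (auto simp: jumps_def)
  note r = left_lim_range[OF assms(1) a(1)] G0_range[OF assms(1), of a] G0_left_lim(3)[OF assms(1) a(1)]
  have pos: "0 < h' (left_lim g a)" "0 < h' (g a)" "0 < q (left_lim g a) (g a)"
    using r by (auto intro!: h'_pos q_pos)
  have "jump_factor h h' g a = sqrt (h' (left_lim g a) * h' (g a)) / q (left_lim g a) (g a)"
    using a by (simp add: jump_factor_def q_def)
  then show ?thesis
    using pos by (simp add: phi_def ln_div ln_sqrt ln_mult)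
qed

definition Phi_grid :: "nat \<Rightarrow> (real \<Rightarrow> real) \<Rightarrow> real" where
  "Phi_grid n g = (\<Sum>i<n. phi (g (real i / real n)) (g (real (Suc i) / real n)))"

definition Lam_grid :: "nat \<Rightarrow> (real \<Rightarrow> real) \<Rightarrow> real" where
  "Lam_grid n g = (\<Sum>i<n. ln (q (g (real i / real n)) (g (real (Suc i) / real n))) / real n)"

text \<open>At a continuity point \<open>s\<close>, both ends of its grid cell have path values
  tending to \<open>g s\<close>, so \<open>q\<close> tends to its diagonal value
  \<open>h' (g s)\<close>. The jump times form a countable set, which is null.\<close>

lemma tendsto_Lam_grid:
  assumes g: "g \<in> G0"
  shows "(\<lambda>n. Lam_grid n g) \<longlonglongrightarrow> integral {0..1} (\<lambda>s. ln (h' (g s)))"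
proof -
  obtain M where M: "0 \<le> M" "\<And>x y. 0 \<le> x \<Longrightarrow> x \<le> y \<Longrightarrow> y \<le> 1 \<Longrightarrow> \<bar>ln (q x y)\<bar> \<le> M"
    using ln_q_bound by blast
  define c where "c = (\<lambda>n i. ln (q (g (real i / real n)) (g (real (Suc i) / real n))))"
  define f where "f = (\<lambda>n x. \<Sum>i<n. indicator {real i / real n<..real (Suc i) / real n} x * c n i)"
  have cont: "continuous_on {0..1} (\<lambda>x. ln (h' x))"
    using cont_h' h'_pos by (intro continuous_on_ln) (auto simp: less_imp_neq[symmetric])
  have c: "\<bar>c n i\<bar> \<le> M" for n i
    unfolding c_def using G0_range[OF g] by (intro M G0_mono[OF g]) (auto intro: divide_right_mono)
  have fM: "norm (f n x) \<le> indicator {0..1} x * M" for n x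
    unfolding f_def real_norm_def
    by (rule step_sum_abs_le) (auto simp: c M intro: divide_right_mono)
  have [measurable]: "f n \<in> borel_measurable borel" for n
    unfolding f_def by measurable
  have [measurable]: "(\<lambda>s. indicator {0..1} s * ln (h' (g s))) \<in> borel_measurable borel"
    using measurable_G0_path[OF g cont] .
  \<comment> \<open>The points 0 and 1 join the exceptional set: cells are open at the left end, and
    a discontinuity at 1 is not recorded in \<open>jumps\<close>.\<close>
  have lim: "(\<lambda>n. f n s) \<longlonglongrightarrow> indicator {0..1} s * ln (h' (g s))"
    if s: "s \<notin> insert 0 (insert 1 (jumps g))" for s
  proof (cases "0 < s \<and> s < 1")
    case False
    then have "s < 0 \<or> 1 < s" using s by auto
    then have "f n s = 0" for n using fM[of n s] by auto
    then show ?thesis using \<open>s < 0 \<or> 1 < s\<close> by auto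
  next
    case True
    then have "left_lim g s = g s" using s by (auto simp: jumps_def)
    then have l: "(\<lambda>n. g ((real_of_int \<lceil>real n * s\<rceil> - 1) / real n)) \<longlonglongrightarrow> g s"
      using G0_ceiling_grid_left[OF g, of s] True by simp
    have r: "(\<lambda>n. g (real_of_int \<lceil>real n * s\<rceil> / real n)) \<longlonglongrightarrow> g s"
      using G0_ceiling_grid[OF g, of s] True by simp
    have c0: "1 \<le> \<lceil>real n * s\<rceil> \<or> n = 0" for n
      using True by (cases "n = 0") (auto simp: one_le_ceiling)
    have "g ((real_of_int \<lceil>real n * s\<rceil> - 1) / real n) \<le> g (real_of_int \<lceil>real n * s\<rceil> / real n)" for n
      using c0[of n] by (intro G0_mono[OF g] divide_right_mono) auto
    then have "(\<lambda>n. q (g ((real_of_int \<lceil>real n * s\<rceil> - 1) / real n)) (g (real_of_int \<lceil>real n * s\<rceil> / real n))) \<longlonglongrightarrow> q (g s) (g s)"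
      using G0_range[OF g] by (intro tendsto_q l r) auto
    moreover have "0 < h' (g s)" using h'_pos G0_range[OF g] by simp
    ultimately have "(\<lambda>n. ln (q (g ((real_of_int \<lceil>real n * s\<rceil> - 1) / real n)) (g (real_of_int \<lceil>real n * s\<rceil> / real n)))) \<longlonglongrightarrow> ln (h' (g s))"
      by (intro tendsto_ln) (auto simp: q_def)
    moreover have "\<forall>\<^sub>F n in sequentially. f n s = ln (q (g ((real_of_int \<lceil>real n * s\<rceil> - 1) / real n)) (g (real_of_int \<lceil>real n * s\<rceil> / real n)))"
      using eventually_gt_at_top[of "0::nat"]
    proof eventually_elim
      case (elim n)
      obtain j where j: "j < n" "real_of_int \<lceil>real n * s\<rceil> = real (Suc j)"
          "real j / real n < s" "s \<le> real (Suc j) / real n"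
        using ceiling_grid_index[of s n] True elim by auto
      have "f n s = c n j"
        unfolding f_def by (rule step_sum) (use j in \<open>auto intro: divide_right_mono\<close>)
      then show ?case unfolding j(2) by (simp add: c_def)
    qed
    ultimately show ?thesis using True by (simp add: tendsto_cong)
  qed
  have ae: "AE s in lborel. s \<notin> insert 0 (insert 1 (jumps g))"
    using countable_jumps[OF g] by (intro AE_not_in countable_imp_null_set_lborel) auto
  have w: "integrable lborel (\<lambda>x::real. indicator {0..1} x * M)"
    by (auto intro!: integrable_mult_left integrable_real_indicator)
  have lim_ae: "AE s in lborel. (\<lambda>n. f n s) \<longlonglongrightarrow> indicator {0..1} s * ln (h' (g s))"
    using ae by eventually_elim (rule lim)
  have "(\<lambda>n. LINT x|lborel. f n x) \<longlonglongrightarrow> (LINT s|lborel. indicator {0..1} s * ln (h' (g s)))"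
    by (rule integral_dominated_convergence[OF _ _ w lim_ae]) (auto simp: fM[unfolded real_norm_def])
  moreover have "(LINT x|lborel. f n x) = Lam_grid n g" for n
    unfolding f_def Lam_grid_def by (subst integral_step_sum)
      (auto simp: c_def divide_right_mono diff_divide_distrib[symmetric])
  moreover have "integrable lborel (\<lambda>s. indicator {0..1} s * ln (h' (g s)))"
    by (rule integrable_dominated_convergence[OF _ _ w lim_ae]) (auto simp: fM[unfolded real_norm_def])
  then have "(LINT s|lborel. indicator {0..1} s * ln (h' (g s))) = integral {0..1} (\<lambda>s. ln (h' (g s)))"
    using set_borel_integral_eq_integral(2)[of "{0..1}" "\<lambda>s. ln (h' (g s))"]
    by (simp add: set_integrable_def set_lebesgue_integral_def)
  ultimately show ?thesis by simp
qed

text \<open>Reading \<open>(y - x) * psi x y\<close> as an integral over the range \<open>{x<..y}\<close> turns the grid sum into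
  the integral of a step function, whose value at \<open>x\<close> converges to \<open>psi\<close> at the jump across \<open>x\<close>.\<close>

lemma tendsto_Phi_grid:
  assumes g: "g \<in> G0" "g 0 = 0" and sup: "\<And>y. y < 1 \<Longrightarrow> \<exists>t. 0 \<le> t \<and> t < 1 \<and> y < g t"
  shows "(\<lambda>n. Phi_grid n g) \<longlonglongrightarrow> (\<Sum>\<^sub>\<infinity>a\<in>jumps g. ln (jump_factor h h' g a))"
proof -
  obtain L where L: "0 \<le> L" "\<And>x y. 0 \<le> x \<Longrightarrow> x \<le> y \<Longrightarrow> y \<le> 1 \<Longrightarrow> \<bar>psi x y\<bar> \<le> L"
    using psi_bound by blast
  define u where "u = (\<lambda>n i. g (real i / real n))"
  define c where "c = (\<lambda>n i. psi (u n i) (u n (Suc i)))"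
  define f where "f = (\<lambda>n x. \<Sum>i<n. indicator {u n i<..u n (Suc i)} x * c n i)"
  have u: "u n i \<le> u n j" if "i \<le> j" for n i j
    unfolding u_def using that by (intro G0_mono[OF g(1)] divide_right_mono) auto
  have u01: "0 \<le> u n i" "u n i \<le> 1" for n i
    using G0_range[OF g(1)] by (auto simp: u_def)
  have c: "\<bar>c n i\<bar> \<le> L" for n i
    unfolding c_def by (intro L u u01) auto
  have fL: "norm (f n x) \<le> indicator {0..1} x * L" for n x
    unfolding f_def real_norm_def by (rule step_sum_abs_le) (auto simp: c L u u01)
  have [measurable]: "f n \<in> borel_measurable borel" for n
    unfolding f_def by measurable
  have j: "0 < a" "0 \<le> left_lim g a" "left_lim g a \<le> g a" "g a \<le> 1" if "a \<in> jumps g" for a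
    using that left_lim_range[OF g(1)] G0_range[OF g(1)] G0_left_lim(3)[OF g(1)] by (auto simp: jumps_def)
  have jb: "\<bar>psi (left_lim g a) (g a)\<bar> \<le> L" if "a \<in> jumps g" for a
    using j[OF that] by (intro L) auto
  obtain F where F[measurable]: "F \<in> borel_measurable borel"
    and F1: "\<And>a x. a \<in> jumps g \<Longrightarrow> x \<in> {left_lim g a<..g a} \<Longrightarrow> F x = psi (left_lim g a) (g a)"
    and F0: "\<And>x. (\<And>a. a \<in> jumps g \<Longrightarrow> x \<notin> {left_lim g a<..g a}) \<Longrightarrow> F x = 0"
    and FI: "(LINT x|lborel. F x) = (\<Sum>\<^sub>\<infinity>a\<in>jumps g. (g a - left_lim g a) * psi (left_lim g a) (g a))"
    using G0_jump_sum_integral[OF g(1), of "\<lambda>a. psi (left_lim g a) (g a)" L] jb by blast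
  \<comment> \<open>The lower ends of the jump intervals are excluded: there \<open>F\<close> may
    vanish although the grid cell crossing that level straddles the jump.\<close>
  have lim: "(\<lambda>n. f n x) \<longlonglongrightarrow> F x" if x: "x \<notin> insert 0 (insert 1 (left_lim g ` jumps g))" for x
  proof (cases "0 < x \<and> x < 1")
    case False
    then have *: "x < 0 \<or> 1 < x" using x by auto
    then have "f n x = 0" for n using fL[of n x] by auto
    moreover have "F x = 0"
    proof (rule F0)
      show "x \<notin> {left_lim g a<..g a}" if "a \<in> jumps g" for a using j[OF that] * by auto
    qed
    ultimately show ?thesis by simp
  next
    case True
    \<comment> \<open>The time cell containing the quantile \<open>a\<close> is the one whose range
      interval contains \<open>x\<close>, so \<open>f n x\<close> is \<open>psi\<close> of the path
      values at the ends of that cell.\<close>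
    then obtain a where a: "0 < a" "a < 1" "x \<le> g a" "\<And>t. 0 \<le> t \<Longrightarrow> t < a \<Longrightarrow> g t < x"
      using G0_quantile[OF g sup, of x] by blast
    have lx: "left_lim g a \<le> x"
      using a by (intro G0_left_lim(4)[OF g(1)]) (auto intro: less_imp_le)
    have Fx: "F x = psi (left_lim g a) (g a)"
    proof (cases "a \<in> jumps g")
      case True
      moreover have "left_lim g a \<noteq> x" using x True by auto
      ultimately show ?thesis using lx a by (intro F1) auto
    next
      case False
      \<comment> \<open>If the crossing is continuous, no jump interval covers \<open>x\<close>: a
        jump elsewhere would lie entirely above or below this level. Then \<open>F x = 0\<close>
        agrees with \<open>psi\<close> on the diagonal.\<close>
      have "x \<notin> {left_lim g b<..g b}" if b: "b \<in> jumps g" for b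
      proof
        assume xb: "x \<in> {left_lim g b<..g b}"
        have "\<not> a < b" using G0_left_lim(2)[OF g(1), of b a] j[OF b] a xb by auto
        moreover have "\<not> b < a" using a(4)[of b] j[OF b] xb by auto
        ultimately show False using False b by auto
      qed
      then have "F x = 0" by (rule F0)
      moreover have "left_lim g a = g a" using False a by (auto simp: jumps_def)
      ultimately show ?thesis by simp
    qed
    have c0: "1 \<le> \<lceil>real n * a\<rceil> \<or> n = 0" for n
      using a by (cases "n = 0") (auto simp: one_le_ceiling)
    have "g ((real_of_int \<lceil>real n * a\<rceil> - 1) / real n) \<le> g (real_of_int \<lceil>real n * a\<rceil> / real n)" for n
      using c0[of n] by (intro G0_mono[OF g(1)] divide_right_mono) auto
    then have "(\<lambda>n. psi (g ((real_of_int \<lceil>real n * a\<rceil> - 1) / real n)) (g (real_of_int \<lceil>real n * a\<rceil> / real n))) \<longlonglongrightarrow> psi (left_lim g a) (g a)"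
      using G0_range[OF g(1)] a
      by (intro tendsto_psi G0_ceiling_grid[OF g(1)] G0_ceiling_grid_left[OF g(1)]) auto
    moreover have "\<forall>\<^sub>F n in sequentially. f n x = psi (g ((real_of_int \<lceil>real n * a\<rceil> - 1) / real n)) (g (real_of_int \<lceil>real n * a\<rceil> / real n))"
      using eventually_gt_at_top[of "0::nat"]
    proof eventually_elim
      case (elim n)
      obtain j where j: "j < n" "real_of_int \<lceil>real n * a\<rceil> = real (Suc j)"
          "real j / real n < a" "a \<le> real (Suc j) / real n"
        using ceiling_grid_index[of a n] a elim by auto
      have "u n j < x" using a(4)[of "real j / real n"] j by (simp add: u_def)
      moreover have "x \<le> u n (Suc j)"
        using a(1,3) G0_mono[OF g(1), of a "real (Suc j) / real n"] j(4) by (simp add: u_def)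
      ultimately have "f n x = c n j"
        unfolding f_def by (intro step_sum) (use j u in auto)
      then show ?case unfolding j(2) by (simp add: c_def u_def)
    qed
    ultimately show ?thesis by (simp add: tendsto_cong Fx)
  qed
  have ae: "AE x in lborel. x \<notin> insert 0 (insert 1 (left_lim g ` jumps g))"
    using countable_jumps[OF g(1)] by (intro AE_not_in countable_imp_null_set_lborel) auto
  have w: "integrable lborel (\<lambda>x::real. indicator {0..1} x * L)"
    by (auto intro!: integrable_mult_left integrable_real_indicator)
  have lim_ae: "AE x in lborel. (\<lambda>n. f n x) \<longlonglongrightarrow> F x"
    using ae by eventually_elim (rule lim)
  have "(\<lambda>n. LINT x|lborel. f n x) \<longlonglongrightarrow> (LINT x|lborel. F x)"
    by (rule integral_dominated_convergence[OF _ _ w lim_ae]) (auto simp: fL[unfolded real_norm_def])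
  moreover have "(LINT x|lborel. f n x) = Phi_grid n g" for n
  proof -
    have "(LINT x|lborel. f n x) = (\<Sum>i<n. (u n (Suc i) - u n i) * c n i)"
      unfolding f_def by (rule integral_step_sum) (simp add: u)
    then show ?thesis by (simp only: c_def psi_eq_phi Phi_grid_def u_def)
  qed
  ultimately show ?thesis
    using ln_jump_factor[OF g(1)] by (simp add: FI cong: infsum_cong)
qed

end

section \<open>Change of variables on a product\<close>

text \<open>By uniqueness of product measures it suffices to compare boxes, where the integral
  factorizes; the probability assumption supplies sigma-finiteness of the factors.\<close>

lemma PiM_density_lborel:
  fixes f :: "real \<Rightarrow> ennreal"
  assumes I: "finite I" and f[measurable]: "f \<in> borel_measurable borel"
    and P: "prob_space (density lborel f)"
  shows "PiM I (\<lambda>_. density lborel f) = density (PiM I (\<lambda>_. lborel)) (\<lambda>x. \<Prod>i\<in>I. f (x i))"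
proof -
  interpret P: prob_space "density lborel f" by fact
  interpret D: product_sigma_finite "\<lambda>_. density lborel f"
    by (simp add: product_sigma_finite_def P.sigma_finite_measure_axioms)
  interpret L: product_sigma_finite "\<lambda>_. lborel :: real measure"
    by (simp add: product_sigma_finite_def sigma_finite_lborel)
  have [measurable_cong]: "sets (PiM I (\<lambda>_. density lborel f)) = sets (PiM I (\<lambda>_. lborel))"
    by (intro sets_PiM_cong) auto
  show ?thesis
  proof (rule D.PiM_eqI[OF I, symmetric])
    show "sets (density (PiM I (\<lambda>_. lborel)) (\<lambda>x. \<Prod>i\<in>I. f (x i))) = sets (PiM I (\<lambda>_. density lborel f))"
      by (simp cong: sets_PiM_cong)
    fix A assume "\<And>i. i \<in> I \<Longrightarrow> A i \<in> sets (density lborel f)"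
    then have A[measurable]: "\<And>i. i \<in> I \<Longrightarrow> A i \<in> sets borel" by simp
    have PiE[measurable]: "PiE I A \<in> sets (PiM I (\<lambda>_. lborel))"
      using I A by (intro sets_PiM_I_finite) auto
    have "emeasure (density (PiM I (\<lambda>_. lborel)) (\<lambda>x. \<Prod>i\<in>I. f (x i))) (PiE I A) =
        (\<integral>\<^sup>+x. (\<Prod>i\<in>I. f (x i)) * indicator (PiE I A) x \<partial>PiM I (\<lambda>_. lborel))"
      using I by (intro emeasure_density PiE) measurable
    also have "\<dots> = (\<integral>\<^sup>+x. (\<Prod>i\<in>I. f (x i) * indicator (A i) (x i)) \<partial>PiM I (\<lambda>_. lborel))"
    proof (rule nn_integral_cong)
      fix x assume x: "x \<in> space (PiM I (\<lambda>_. lborel :: real measure))"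
      have "(\<Prod>i\<in>I. indicator (A i) (x i)) = (indicator (PiE I A) x :: ennreal)"
      proof (cases "x \<in> PiE I A")
        case True
        then show ?thesis by (auto simp: PiE_mem intro!: prod.neutral)
      next
        case False
        then obtain i where "i \<in> I" "x i \<notin> A i"
          using x by (auto simp: space_PiM PiE_iff)
        then show ?thesis using I False by (auto intro!: prod_zero bexI[of _ i])
      qed
      then show "(\<Prod>i\<in>I. f (x i)) * indicator (PiE I A) x = (\<Prod>i\<in>I. f (x i) * indicator (A i) (x i))"
        by (simp add: prod.distrib)
    qed
    also have "\<dots> = (\<Prod>i\<in>I. \<integral>\<^sup>+x. f x * indicator (A i) x \<partial>lborel)"
      using I A by (intro L.product_nn_integral_prod) auto
    also have "\<dots> = (\<Prod>i\<in>I. emeasure (density lborel f) (A i))"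
      using A by (intro prod.cong) (auto simp: emeasure_density)
    finally show "emeasure (density (PiM I (\<lambda>_. lborel)) (\<lambda>x. \<Prod>i\<in>I. f (x i))) (PiE I A) = \<dots>" .
  qed
qed

text \<open>A retraction onto the unit interval. \<open>h\<close>, \<open>h'\<close> and the inverse
  of \<open>h\<close> are uncontrolled outside it, and composing with the retraction yields Borel
  functions on the whole line.\<close>

definition clamp01 :: "real \<Rightarrow> real" where
  "clamp01 x = max 0 (min 1 x)"

lemma clamp01_in [simp]: "0 \<le> clamp01 x" "clamp01 x \<le> 1"
  and clamp01_id: "0 \<le> x \<Longrightarrow> x \<le> 1 \<Longrightarrow> clamp01 x = x"
  by (auto simp: clamp01_def)

lemma measurable_clamp01:
  assumes "continuous_on {0..1} f"
  shows "(\<lambda>x. f (clamp01 x) :: real) \<in> borel_measurable borel"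
  unfolding clamp01_def
  by (intro borel_measurable_continuous_onI continuous_on_compose2[OF assms] continuous_intros) auto

lemma prob_space_uniform01: "prob_space (density lborel (indicator {0..1::real}))"
  by (rule prob_spaceI) (simp add: emeasure_density)

context C2_iso01
begin

lemma measurable_clamp_h [measurable]: "(\<lambda>x. h (clamp01 x)) \<in> borel_measurable borel"
  and measurable_clamp_h' [measurable]: "(\<lambda>x. h' (clamp01 x)) \<in> borel_measurable borel"
  by (intro measurable_clamp01 cont_h cont_h')+

text \<open>The density of the law with distribution function \<open>h\<close>, which
  \<open>h\<close> maps to the uniform law.\<close>

definition dens01 :: "real \<Rightarrow> ennreal" where
  "dens01 y = ennreal (indicator {0..1} y * h' (clamp01 y))"

lemma measurable_dens01 [measurable]: "dens01 \<in> borel_measurable borel"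
  unfolding dens01_def by measurable

lemma nn_integral_h':
  assumes "0 \<le> c" "c \<le> 1"
  shows "(\<integral>\<^sup>+y. ennreal (indicator {c..1} y * h' y) \<partial>lborel) = ennreal (1 - h c)"
proof (rule nn_integral_has_integral_lebesgue)
  show "0 \<le> h' y" if "y \<in> {c..1}" for y
    using h'_pos[of y] that assms by auto
  have "(h' has_integral h 1 - h c) {c..1}"
    using assms
    by (intro fundamental_theorem_of_calculus)
      (auto simp flip: has_real_derivative_iff_has_vector_derivative
        intro!: has_field_derivative_subset[OF deriv_h])
  then show "(h' has_integral 1 - h c) {c..1}" by simp
qed

lemma emeasure_dens01:
  "emeasure (density lborel dens01) {y. x < h (clamp01 y)} = ennreal (1 - clamp01 x)"
proof -
  have "clamp01 x \<in> h ` {0..1}" unfolding h_onto by simp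
  then obtain c where c: "0 \<le> c" "c \<le> 1" "h c = clamp01 x" by auto
  have "emeasure (density lborel dens01) {y. x < h (clamp01 y)} =
      (\<integral>\<^sup>+y. dens01 y * indicator {y. x < h (clamp01 y)} y \<partial>lborel)"
    by (rule emeasure_density) measurable
  also have "\<dots> = (\<integral>\<^sup>+y. ennreal (indicator {c..1} y * h' y) \<partial>lborel)"
  proof (rule nn_integral_cong_AE)
    \<comment> \<open>The event is \<open>y > c\<close> within the unit interval, up to the single
      point \<open>c\<close>, where the two integrands may differ.\<close>
    have "AE y in lborel. y \<notin> {c}"
      by (intro AE_not_in countable_imp_null_set_lborel) auto
    then show "AE y in lborel. dens01 y * indicator {y. x < h (clamp01 y)} y = ennreal (indicator {c..1} y * h' y)"
    proof eventually_elim
      case (elim y)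
      show ?case
      proof (cases "y \<in> {0..1}")
        case True
        have hy: "0 \<le> h y" "h y \<le> 1" using True h_onto by auto
        have "c < y \<Longrightarrow> x < h y"
          using h_less_iff[of c y] c True hy by (auto simp: clamp01_def split: if_splits)
        moreover have "y < c \<Longrightarrow> \<not> x < h y"
          using h_less_iff[of y c] c True hy by (auto simp: clamp01_def)
        ultimately show ?thesis
          using True elim by (cases "c < y") (auto simp: dens01_def clamp01_id indicator_def)
      next
        case False
        then show ?thesis using c by (auto simp: dens01_def indicator_def)
      qed
    qed
  qed
  also have "\<dots> = ennreal (1 - clamp01 x)"
    using nn_integral_h'[of c] c by simp
  finally show ?thesis .
qed

lemma prob_space_dens01: "prob_space (density lborel dens01)"
proof (rule prob_spaceI)
  have "-1 < h (clamp01 y)" for y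
    using h_le_iff[of 0 "clamp01 y"] by simp
  then have "{y. -1 < h (clamp01 y)} = UNIV" by simp
  then show "emeasure (density lborel dens01) (space (density lborel dens01)) = 1"
    using emeasure_dens01[of "-1"] by (simp add: clamp01_def)
qed

text \<open>The one-dimensional substitution rule in the form of a pushforward, verified on upper
  tails.\<close>

lemma distr_dens01: "distr (density lborel dens01) borel (\<lambda>x. h (clamp01 x)) = density lborel (indicator {0..1})"
proof (rule measure_eqI_lessThan)
  have *: "emeasure (distr (density lborel dens01) borel (\<lambda>x. h (clamp01 x))) {x<..} = ennreal (1 - clamp01 x)" for x
    using emeasure_dens01[of x] by (subst emeasure_distr) (auto simp: vimage_def)
  show "emeasure (distr (density lborel dens01) borel (\<lambda>x. h (clamp01 x))) {x<..} < \<infinity>" for x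
    by (simp add: *)
  have "emeasure (density lborel (indicator {0..1})) {x<..} = emeasure lborel ({0..1} \<inter> {x<..})" for x :: real
    by (subst emeasure_density) (auto simp flip: indicator_inter_arith)
  moreover have "emeasure lborel ({0..1} \<inter> {x<..}) = ennreal (1 - clamp01 x)" for x :: real
  proof -
    consider "x < 0" | "0 \<le> x" "x \<le> 1" | "1 < x" by linarith
    then show ?thesis
    proof cases
      case 1
      then have "{0..1} \<inter> {x<..} = {0..1}" by auto
      then show ?thesis using 1 by (simp add: clamp01_def)
    next
      case 2
      then have "{0..1} \<inter> {x<..} = {x<..1}" by auto
      then show ?thesis using 2 by (simp add: clamp01_def)
    next
      case 3
      then have "{0..1} \<inter> {x<..} = {}" by auto
      then show ?thesis using 3 by (simp add: clamp01_def)
    qed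
  qed
  ultimately show "emeasure (distr (density lborel dens01) borel (\<lambda>x. h (clamp01 x))) {x<..} =
      emeasure (density lborel (indicator {0..1})) {x<..}" for x
    by (simp add: *)
qed auto

text \<open>The substitution \<open>x i = h (y i)\<close> without a multivariate Jacobian: the
  support condition lets Lebesgue measure be replaced by the uniform product law, which is the
  componentwise image of the product of \<open>dens01\<close> laws.\<close>

lemma nn_integral_PiM_change_of_variables:
  assumes I: "finite I" and f[measurable]: "f \<in> borel_measurable (PiM I (\<lambda>_. lborel))"
    and supp: "\<And>x i. i \<in> I \<Longrightarrow> x i \<notin> {0..1} \<Longrightarrow> f x = 0"
  shows "(\<integral>\<^sup>+x. f x \<partial>PiM I (\<lambda>_. lborel)) =
    (\<integral>\<^sup>+y. (\<Prod>i\<in>I. dens01 (y i)) * f (\<lambda>i\<in>I. h (clamp01 (y i))) \<partial>PiM I (\<lambda>_. lborel))"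
proof -
  have [measurable_cong]: "sets (PiM I (\<lambda>_. density lborel g)) = sets (PiM I (\<lambda>_. lborel))" for g :: "real \<Rightarrow> ennreal"
    by (intro sets_PiM_cong) auto
  have [measurable_cong]: "sets (PiM I (\<lambda>_. borel :: real measure)) = sets (PiM I (\<lambda>_. lborel))"
    by (intro sets_PiM_cong) auto
  have comp[measurable]: "compose I (\<lambda>x. h (clamp01 x)) \<in> measurable (PiM I (\<lambda>_. lborel)) (PiM I (\<lambda>_. lborel))"
    unfolding compose_def by measurable
  have "(\<integral>\<^sup>+x. f x \<partial>PiM I (\<lambda>_. lborel)) =
      (\<integral>\<^sup>+x. (\<Prod>i\<in>I. indicator {0..1} (x i)) * f x \<partial>PiM I (\<lambda>_. lborel))"
  proof (rule nn_integral_cong)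
    fix x
    show "f x = (\<Prod>i\<in>I. indicator {0..1} (x i)) * f x"
    proof (cases "\<forall>i\<in>I. x i \<in> {0..1}")
      case True
      then show ?thesis by (simp add: prod.neutral)
    next
      case False
      then show ?thesis using supp[of _ x] by auto
    qed
  qed
  also have "\<dots> = (\<integral>\<^sup>+x. f x \<partial>density (PiM I (\<lambda>_. lborel)) (\<lambda>x. \<Prod>i\<in>I. indicator {0..1} (x i)))"
    using I by (subst nn_integral_density) auto
  also have "\<dots> = (\<integral>\<^sup>+x. f x \<partial>PiM I (\<lambda>_. density lborel (indicator {0..1})))"
    using I by (subst PiM_density_lborel) (auto simp: prob_space_uniform01)
  also have "\<dots> = (\<integral>\<^sup>+x. f x \<partial>PiM I (\<lambda>_. distr (density lborel dens01) lborel (\<lambda>x. h (clamp01 x))))"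
    using distr_dens01 by (simp cong: distr_cong)
  also have "\<dots> = (\<integral>\<^sup>+x. f x \<partial>distr (PiM I (\<lambda>_. density lborel dens01)) (PiM I (\<lambda>_. density lborel dens01))
      (compose I (\<lambda>x. h (clamp01 x))))"
  proof (subst distr_PiM_finite_prob_space'[OF I prob_space_dens01 prob_space_dens01])
    show "(\<lambda>x. h (clamp01 x)) \<in> density lborel dens01 \<rightarrow>\<^sub>M density lborel dens01" by measurable
    show "(\<integral>\<^sup>+x. f x \<partial>PiM I (\<lambda>_. distr (density lborel dens01) lborel (\<lambda>x. h (clamp01 x)))) =
        (\<integral>\<^sup>+x. f x \<partial>PiM I (\<lambda>i. distr (density lborel dens01) (density lborel dens01) (\<lambda>x. h (clamp01 x))))"
      by (simp cong: distr_cong)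
  qed
  also have "\<dots> = (\<integral>\<^sup>+y. f (compose I (\<lambda>x. h (clamp01 x)) y) \<partial>PiM I (\<lambda>_. density lborel dens01))"
    by (rule nn_integral_distr) measurable
  also have "\<dots> = (\<integral>\<^sup>+y. (\<Prod>i\<in>I. dens01 (y i)) * f (compose I (\<lambda>x. h (clamp01 x)) y) \<partial>PiM I (\<lambda>_. lborel))"
    using I by (subst PiM_density_lborel) (auto simp: prob_space_dens01 nn_integral_density)
  finally show ?thesis by (simp add: compose_def)
qed

end

section \<open>Finite dimensional marginals\<close>

lemma is_Q0D:
  assumes "is_Q0 \<beta> Q"
  shows "prob_space Q" "sets Q = sets G0M" "space Q = G0"
    "\<And>N t. (\<And>i. i \<le> N \<Longrightarrow> ext01 N t i < ext01 N t (Suc i)) \<Longrightarrow>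
        distr Q (Pi\<^sub>M {1..N} (\<lambda>_. lborel)) (\<lambda>g. \<lambda>i\<in>{1..N}. g (t i)) =
        density (Pi\<^sub>M {1..N} (\<lambda>_. lborel)) (\<lambda>x. ennreal (dirichlet_fdd_density \<beta> N t x))"
proof -
  show "prob_space Q" "sets Q = sets G0M" using assms by (auto simp: is_Q0_def)
  from sets_eq_imp_space_eq[OF this(2)] show "space Q = G0"
    by (simp add: G0M_def space_restrict_space space_PiM)
  show "\<And>N t. (\<And>i. i \<le> N \<Longrightarrow> ext01 N t i < ext01 N t (Suc i)) \<Longrightarrow>
        distr Q (Pi\<^sub>M {1..N} (\<lambda>_. lborel)) (\<lambda>g. \<lambda>i\<in>{1..N}. g (t i)) =
        density (Pi\<^sub>M {1..N} (\<lambda>_. lborel)) (\<lambda>x. ennreal (dirichlet_fdd_density \<beta> N t x))"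
    using assms by (auto simp: is_Q0_def)
qed

lemma measurable_G0M_eval: "(\<lambda>g. g t) \<in> borel_measurable G0M"
  unfolding G0M_def by (intro measurable_restrict_space1 measurable_component_singleton) simp

lemma measurable_is_Q0_eval:
  assumes "is_Q0 \<beta> Q"
  shows "(\<lambda>g. g t) \<in> borel_measurable Q"
  using measurable_G0M_eval is_Q0D(2)[OF assms] by (simp cong: measurable_cong_sets)

lemma measurable_ext01 [measurable]:
  "(\<lambda>x. ext01 N x i) \<in> borel_measurable (Pi\<^sub>M {1..N} (\<lambda>_. lborel))"
proof (cases "i \<in> {1..N}")
  case True
  then show ?thesis by (auto simp: ext01_def)
next
  case False
  \<comment> \<open>Points of the product space are extensional, so coordinates outside
    \<open>{1..N}\<close> are the constant \<open>undefined\<close>.\<close>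
  have "ext01 N x i = (if i = 0 then 0 else if i = N + 1 then 1 else undefined :: real)"
    if "x \<in> space (Pi\<^sub>M {1..N} (\<lambda>_. lborel))" for x
    using PiE_arb[OF that[unfolded space_PiM] False] by (simp add: ext01_def)
  then show ?thesis
    by (subst measurable_cong) auto
qed

lemma measurable_dirichlet_fdd_density [measurable]:
  "dirichlet_fdd_density \<beta> N t \<in> borel_measurable (Pi\<^sub>M {1..N} (\<lambda>_. lborel))"
  unfolding dirichlet_fdd_density_def by measurable

lemma measurable_fdd:
  assumes "is_Q0 \<beta> Q"
  shows "(\<lambda>g. \<lambda>i\<in>{1..N}. g (t i)) \<in> measurable Q (Pi\<^sub>M {1..N} (\<lambda>_. lborel))"
  using measurable_is_Q0_eval[OF assms] by (intro measurable_restrict) simp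

lemma nn_integral_fdd:
  assumes Q: "is_Q0 \<beta> Q" and t: "\<And>i. i \<le> N \<Longrightarrow> ext01 N t i < ext01 N t (Suc i)"
    and U[measurable]: "U \<in> borel_measurable (Pi\<^sub>M {1..N} (\<lambda>_. lborel))"
  shows "(\<integral>\<^sup>+g. U (\<lambda>i\<in>{1..N}. g (t i)) \<partial>Q) =
    (\<integral>\<^sup>+x. ennreal (dirichlet_fdd_density \<beta> N t x) * U x \<partial>Pi\<^sub>M {1..N} (\<lambda>_. lborel))"
proof -
  have d: "distr Q (Pi\<^sub>M {1..N} (\<lambda>_. lborel)) (\<lambda>g. \<lambda>i\<in>{1..N}. g (t i)) =
      density (Pi\<^sub>M {1..N} (\<lambda>_. lborel)) (\<lambda>x. ennreal (dirichlet_fdd_density \<beta> N t x))"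
    by (rule is_Q0D(4)[OF Q]) (rule t)
  have "(\<integral>\<^sup>+g. U (\<lambda>i\<in>{1..N}. g (t i)) \<partial>Q) =
      (\<integral>\<^sup>+x. U x \<partial>distr Q (Pi\<^sub>M {1..N} (\<lambda>_. lborel)) (\<lambda>g. \<lambda>i\<in>{1..N}. g (t i)))"
    using U by (intro nn_integral_distr[symmetric] measurable_fdd[OF Q]) auto
  also have "\<dots> = (\<integral>\<^sup>+x. ennreal (dirichlet_fdd_density \<beta> N t x) * U x \<partial>Pi\<^sub>M {1..N} (\<lambda>_. lborel))"
    unfolding d by (rule nn_integral_density) measurable
  finally show ?thesis .
qed

text \<open>The marginal at time \<open>t\<close> is the Beta law with parameters
  \<open>a = \<beta> * t\<close> and \<open>b = \<beta> * (1 - t)\<close>, whose mean is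
  \<open>a / (a + b)\<close>. The computation reduces to the recursion
  \<open>(a + b) * Beta (a + 1) b = a * Beta a b\<close>.\<close>

lemma Q0_mean:
  assumes \<beta>: "0 < \<beta>" and Q: "is_Q0 \<beta> Q" and t: "0 < t" "t < 1"
  shows "(\<integral>\<^sup>+g. ennreal (g t) \<partial>Q) = ennreal t"
proof -
  interpret L: product_sigma_finite "\<lambda>_. lborel :: real measure"
    by (simp add: product_sigma_finite_def sigma_finite_lborel)
  define a b where "a = \<beta> * t" and "b = \<beta> * (1 - t)"
  have ab: "0 < a" "0 < b" "a + b = \<beta>" using \<beta> t by (auto simp: a_def b_def algebra_simps)
  define C where "C = Gamma \<beta> / (Gamma a * Gamma b)"
  have C0: "0 < C" using ab \<beta> by (auto simp: C_def Gamma_real_pos)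
  define f where "f = (\<lambda>x. indicator {0<..<1} x * (C * (x powr a * (1 - x) powr (b - 1))))"
  have [measurable]: "f \<in> borel_measurable borel" unfolding f_def by measurable
  have eq: "ennreal (dirichlet_fdd_density \<beta> 1 (\<lambda>_. t) x) * ennreal (x 1) = ennreal (f (x 1))" for x
  proof (cases "0 < x 1 \<and> x 1 < 1")
    case True
    then have "dirichlet_fdd_density \<beta> 1 (\<lambda>_. t) x = C * (x 1 powr (a - 1) * (1 - x 1) powr (b - 1))"
      by (simp add: dirichlet_fdd_density_def ext01_def atMost_Suc C_def a_def b_def le_Suc_eq mult.commute)
    moreover have "x 1 powr (a - 1) * x 1 = x 1 powr a"
      using True by (simp add: powr_diff)
    then have "C * (x 1 powr (a - 1) * (1 - x 1) powr (b - 1)) * x 1 = f (x 1)"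
      using True by (simp add: f_def)
    ultimately show ?thesis
      using True by (simp add: ennreal_mult''[symmetric])
  next
    case False
    then have "\<not> (\<forall>i\<le>1. ext01 1 x i < ext01 1 x (i + 1))"
      by (auto simp: ext01_def le_Suc_eq)
    then have "dirichlet_fdd_density \<beta> 1 (\<lambda>_. t) x = 0"
      unfolding dirichlet_fdd_density_def by (rule if_not_P)
    then show ?thesis using False by (auto simp: f_def)
  qed
  have tt: "ext01 1 (\<lambda>_. t) i < ext01 1 (\<lambda>_. t) (Suc i)" if "i \<le> 1" for i
    using that t by (auto simp: ext01_def le_Suc_eq)
  have "(\<integral>\<^sup>+g. ennreal (g t) \<partial>Q) = (\<integral>\<^sup>+g. ennreal ((\<lambda>i\<in>{1..1::nat}. g t) 1) \<partial>Q)"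
    by simp
  also have "\<dots> = (\<integral>\<^sup>+x. ennreal (dirichlet_fdd_density \<beta> 1 (\<lambda>_. t) x) * ennreal (x 1) \<partial>Pi\<^sub>M {1..1} (\<lambda>_. lborel))"
  proof (rule nn_integral_fdd[OF Q, of 1 "\<lambda>_. t" "\<lambda>x. ennreal (x 1)", OF tt])
    show "(\<lambda>x. ennreal (x 1)) \<in> borel_measurable (Pi\<^sub>M {1..1::nat} (\<lambda>_. lborel))"
      by simp
  qed
  also have "\<dots> = (\<integral>\<^sup>+x. ennreal (f (x 1)) \<partial>Pi\<^sub>M {1::nat} (\<lambda>_. lborel))"
    unfolding eq by (simp only: atLeastAtMost_singleton)
  also have "\<dots> = (\<integral>\<^sup>+x. ennreal (f x) \<partial>lborel)"
    by (rule L.product_nn_integral_singleton) measurable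
  also have "\<dots> = ennreal (C * Beta (a + 1) b)"
    unfolding f_def
  proof (rule nn_integral_has_integral_lebesgue)
    show "0 \<le> C * (x powr a * (1 - x) powr (b - 1))" for x
      using C0 by simp
    have "((\<lambda>x. x powr (a + 1 - 1) * (1 - x) powr (b - 1)) has_integral Beta (a + 1) b) {0..1}"
      using ab by (intro has_integral_Beta_real) auto
    then have "((\<lambda>x. x powr a * (1 - x) powr (b - 1)) has_integral Beta (a + 1) b) {0<..<1}"
      by (simp add: has_integral_Icc_iff_Ioo)
    then show "((\<lambda>x. C * (x powr a * (1 - x) powr (b - 1))) has_integral C * Beta (a + 1) b) {0<..<1}"
      by (rule has_integral_mult_right)
  qed
  also have "C * Beta (a + 1) b = t"
  proof -
    have np: "a \<notin> \<int>\<^sub>\<le>\<^sub>0" using ab by (auto elim!: nonpos_Ints_cases)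
    have "\<beta> * Beta (a + 1) b = a * Beta a b"
      using Beta_plus1_left[OF np, of b] ab by simp
    moreover have "Beta a b = Gamma a * Gamma b / Gamma \<beta>"
      by (simp add: Beta_def ab)
    moreover have "0 < Gamma a" "0 < Gamma b" "0 < Gamma \<beta>"
      using ab \<beta> by (auto simp: Gamma_real_pos)
    ultimately show ?thesis
      using \<beta> by (simp add: C_def a_def field_simps)
  qed
  finally show ?thesis .
qed

lemma Q0_mean':
  assumes \<beta>: "0 < \<beta>" and Q: "is_Q0 \<beta> Q" and t: "0 < t" "t < 1"
  shows "(\<integral>\<^sup>+g. ennreal (1 - g t) \<partial>Q) = ennreal (1 - t)"
proof -
  interpret prob_space Q by (rule is_Q0D(1)[OF Q])
  note [measurable] = measurable_is_Q0_eval[OF Q]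
  have "ennreal t + (\<integral>\<^sup>+g. ennreal (1 - g t) \<partial>Q) = (\<integral>\<^sup>+g. ennreal (g t) + ennreal (1 - g t) \<partial>Q)"
    by (subst nn_integral_add) (auto simp: Q0_mean[OF \<beta> Q t])
  also have "\<dots> = (\<integral>\<^sup>+g. 1 \<partial>Q)"
    using G0_range by (intro nn_integral_cong) (auto simp: is_Q0D(3)[OF Q] simp flip: ennreal_plus)
  also have "\<dots> = ennreal t + ennreal (1 - t)"
    using t by (simp add: emeasure_space_1 flip: ennreal_plus)
  finally show ?thesis by (simp add: ennreal_add_left_cancel)
qed

text \<open>The marginals concern only times strictly between 0 and 1, so time 0 is reached by
  monotonicity: the mean of \<open>g 0\<close> is below the mean \<open>t\<close> of
  \<open>g t\<close> for every such \<open>t\<close>. Two successors keep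
  \<open>1 / real (Suc (Suc n))\<close> below 1.\<close>

lemma AE_Q0_at_0:
  assumes \<beta>: "0 < \<beta>" and Q: "is_Q0 \<beta> Q"
  shows "AE g in Q. g 0 = 0"
proof -
  note [measurable] = measurable_is_Q0_eval[OF Q]
  have le: "(\<integral>\<^sup>+g. ennreal (g 0) \<partial>Q) \<le> ennreal (1 / real (Suc (Suc n)))" for n
  proof -
    have "(\<integral>\<^sup>+g. ennreal (g 0) \<partial>Q) \<le> (\<integral>\<^sup>+g. ennreal (g (1 / real (Suc (Suc n)))) \<partial>Q)"
    proof (intro nn_integral_mono ennreal_leI)
      fix g assume "g \<in> space Q"
      then show "g 0 \<le> g (1 / real (Suc (Suc n)))"
        using G0_mono[of g 0 "1 / real (Suc (Suc n))"] is_Q0D(3)[OF Q] by simp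
    qed
    also have "\<dots> = ennreal (1 / real (Suc (Suc n)))"
      by (intro Q0_mean[OF \<beta> Q]) auto
    finally show ?thesis .
  qed
  have "(\<lambda>n. ennreal (1 / real (Suc (Suc n)))) \<longlonglongrightarrow> ennreal 0"
    by (intro tendsto_ennrealI LIMSEQ_Suc lim_1_over_n)
  then have "(\<integral>\<^sup>+g. ennreal (g 0) \<partial>Q) \<le> ennreal 0"
    using le by (intro LIMSEQ_le_const) blast+
  then have "(\<integral>\<^sup>+g. ennreal (g 0) \<partial>Q) = 0" by simp
  then have "AE g in Q. ennreal (g 0) = 0"
    by (subst (asm) nn_integral_0_iff_AE) auto
  then show ?thesis
    using AE_space
  proof eventually_elim
    case (elim g)
    then show ?case using G0_range[of g 0] is_Q0D(3)[OF Q] by (auto simp: ennreal_eq_0_iff)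
  qed
qed

text \<open>\<open>G\<close> measures the gap between 1 and the left limit at 1; its integral is
  below \<open>1 - t n\<close> for every \<open>n\<close>, hence zero.\<close>

lemma AE_Q0_sup:
  assumes \<beta>: "0 < \<beta>" and Q: "is_Q0 \<beta> Q"
  shows "AE g in Q. \<forall>y<1. \<exists>t. 0 \<le> t \<and> t < 1 \<and> y < g t"
proof -
  note [measurable] = measurable_is_Q0_eval[OF Q]
  define t where "t = (\<lambda>n. 1 - 1 / real (Suc (Suc n)))"
  have t: "0 < t n" "t n < 1" for n by (auto simp: t_def field_simps)
  define G where "G = (\<lambda>g :: real \<Rightarrow> real. INF n. ennreal (1 - g (t n)))"
  have [measurable]: "G \<in> borel_measurable Q" unfolding G_def by measurable
  have le: "(\<integral>\<^sup>+g. G g \<partial>Q) \<le> ennreal (1 / real (Suc (Suc n)))" for n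
  proof -
    have "(\<integral>\<^sup>+g. G g \<partial>Q) \<le> (\<integral>\<^sup>+g. ennreal (1 - g (t n)) \<partial>Q)"
      unfolding G_def by (intro nn_integral_mono INF_lower) auto
    also have "\<dots> = ennreal (1 / real (Suc (Suc n)))"
      by (subst Q0_mean'[OF \<beta> Q t]) (simp add: t_def)
    finally show ?thesis .
  qed
  have "(\<lambda>n. ennreal (1 / real (Suc (Suc n)))) \<longlonglongrightarrow> ennreal 0"
    by (intro tendsto_ennrealI LIMSEQ_Suc lim_1_over_n)
  then have "(\<integral>\<^sup>+g. G g \<partial>Q) \<le> ennreal 0"
    using le by (intro LIMSEQ_le_const) blast+
  then have "(\<integral>\<^sup>+g. G g \<partial>Q) = 0" by simp
  then have "AE g in Q. G g = 0"
    by (subst (asm) nn_integral_0_iff_AE) auto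
  then show ?thesis
  proof eventually_elim
    case (elim g)
    show ?case
    proof (intro allI impI)
      fix y :: real assume "y < 1"
      then have "G g < ennreal (1 - y)" using elim by simp
      then obtain n where "ennreal (1 - g (t n)) < ennreal (1 - y)"
        unfolding G_def by (auto simp: INF_less_iff)
      then have "y < g (t n)"
        using ennreal_leI[of "1 - y" "1 - g (t n)"] by (force simp: not_le[symmetric])
      then show "\<exists>t. 0 \<le> t \<and> t < 1 \<and> y < g t"
        using t[of n] by (auto intro!: exI[of _ "t n"])
    qed
  qed
qed

section \<open>Equidistant marginals under the substitution\<close>

lemma ext01_grid: "i \<le> Suc N \<Longrightarrow> ext01 N (\<lambda>i. real i / real (Suc N)) i = real i / real (Suc N)"
  by (auto simp: ext01_def)

context C2_iso01
begin

abbreviation k :: "real \<Rightarrow> real" where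
  "k \<equiv> the_inv_into {0..1} h"

lemma inj_h: "inj_on h {0..1}"
  using h_mono by (rule strict_mono_on_imp_inj_on)

lemma k_h: "0 \<le> x \<Longrightarrow> x \<le> 1 \<Longrightarrow> k (h x) = x"
  using the_inv_into_f_f[OF inj_h, of x] by simp

lemma h_k: "0 \<le> x \<Longrightarrow> x \<le> 1 \<Longrightarrow> h (k x) = x"
  using f_the_inv_into_f[OF inj_h, of x] h_onto by simp

lemma k_range: "0 \<le> x \<Longrightarrow> x \<le> 1 \<Longrightarrow> 0 \<le> k x \<and> k x \<le> 1"
  using the_inv_into_into[OF inj_h, of x "{0..1}"] h_onto by simp

lemma k_0 [simp]: "k 0 = 0" and k_1 [simp]: "k 1 = 1"
  using k_h[of 0] k_h[of 1] by simp_all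

lemma h_range: "0 \<le> x \<Longrightarrow> x \<le> 1 \<Longrightarrow> 0 \<le> h x \<and> h x \<le> 1"
  using h_onto by auto

lemma k_mono: "0 \<le> x \<Longrightarrow> x \<le> y \<Longrightarrow> y \<le> 1 \<Longrightarrow> k x \<le> k y"
  using h_le_iff[of "k x" "k y"] k_range[of x] k_range[of y] h_k[of x] h_k[of y] by simp

lemma cont_k: "continuous_on {0..1} k"
  using continuous_on_inv[OF cont_h compact_Icc, of k] k_h by (simp add: h_onto)

lemma measurable_clamp_k [measurable]: "(\<lambda>x. k (clamp01 x)) \<in> borel_measurable borel"
  by (rule measurable_clamp01[OF cont_k])

text \<open>The density of the overview as a function of the \<open>N\<close> interior coordinates;
  \<open>grid_Y\<close> is its counterpart on paths. The clamps keep it measurable on the whole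
  product space.\<close>

definition grid_density :: "real \<Rightarrow> nat \<Rightarrow> (nat \<Rightarrow> real) \<Rightarrow> real" where
  "grid_density \<beta> N y =
     exp (\<beta> * (\<Sum>i<Suc N. ln (q (clamp01 (ext01 N y i)) (clamp01 (ext01 N y (Suc i)))) / real (Suc N))
          + (\<Sum>i<Suc N. phi (clamp01 (ext01 N y i)) (clamp01 (ext01 N y (Suc i)))))
     / sqrt (h' 0 * h' 1)"

lemma measurable_q [measurable (raw)]:
  assumes [measurable]: "f \<in> borel_measurable M" "g \<in> borel_measurable M"
  shows "(\<lambda>x. q (clamp01 (f x)) (clamp01 (g x))) \<in> borel_measurable M"
proof -
  have [measurable]: "clamp01 \<in> borel_measurable borel" 
    unfolding clamp01_def[abs_def] by measurable
  have [measurable]: "(\<lambda>x. h (clamp01 (f x))) \<in> borel_measurable M" "(\<lambda>x. h (clamp01 (g x))) \<in> borel_measurable M"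
    "(\<lambda>x. h' (clamp01 (f x))) \<in> borel_measurable M"
    using measurable_compose[OF _ measurable_clamp_h] measurable_compose[OF _ measurable_clamp_h'] by auto
  show ?thesis unfolding q_def by measurable
qed

lemma measurable_phi [measurable (raw)]:
  assumes [measurable]: "f \<in> borel_measurable M" "g \<in> borel_measurable M"
  shows "(\<lambda>x. phi (clamp01 (f x)) (clamp01 (g x))) \<in> borel_measurable M"
proof -
  have [measurable]: "(\<lambda>x. h' (clamp01 (g x))) \<in> borel_measurable M"
    "(\<lambda>x. h' (clamp01 (f x))) \<in> borel_measurable M"
    using measurable_compose[OF _ measurable_clamp_h'] by auto
  show ?thesis unfolding phi_def by measurable
qed

lemma measurable_grid_density [measurable]:
  "grid_density \<beta> N \<in> borel_measurable (Pi\<^sub>M {1..N} (\<lambda>_. lborel))"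
  unfolding grid_density_def by measurable

text \<open>Each increment of \<open>h\<close> is \<open>q\<close> times the increment of
  \<open>z\<close>, so the left side carries \<open>(e - 1) * ln q\<close> per increment and
  \<open>ln (h' z)\<close> per interior point. Summing \<open>phi\<close> counts
  \<open>ln (h' z)\<close> fully at interior points and by half at the ends, and it absorbs the
  \<open>- ln q\<close>.\<close>

lemma prod_powr_telescope:
  fixes z :: "nat \<Rightarrow> real" and e :: real
  assumes z: "\<And>i. i \<le> Suc N \<Longrightarrow> 0 \<le> z i \<and> z i \<le> 1" "\<And>i. i \<le> N \<Longrightarrow> z i < z (Suc i)"
  shows "(\<Prod>i\<le>N. (h (z (Suc i)) - h (z i)) powr (e - 1)) * (\<Prod>i\<in>{1..N}. h' (z i)) =
    (\<Prod>i\<le>N. (z (Suc i) - z i) powr (e - 1)) *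
    (exp (e * (\<Sum>i\<le>N. ln (q (z i) (z (Suc i)))) + (\<Sum>i\<le>N. phi (z i) (z (Suc i))))
      / sqrt (h' (z 0) * h' (z (Suc N))))"
proof -
  have h'z: "0 < h' (z i)" if "i \<le> Suc N" for i using z(1)[OF that] h'_pos by simp
  have qz: "0 < q (z i) (z (Suc i))" if "i \<le> N" for i
    using z(1)[of i] z(1)[of "Suc i"] z(2)[OF that] that by (intro q_pos) auto
  have "(\<Prod>i\<le>N. (h (z (Suc i)) - h (z i)) powr (e - 1)) =
      (\<Prod>i\<le>N. exp ((e - 1) * ln (q (z i) (z (Suc i)))) * (z (Suc i) - z i) powr (e - 1))"
  proof (rule prod.cong[OF refl])
    fix i assume "i \<in> {..N}"
    then have i: "i \<le> N" by simp
    have "h (z (Suc i)) - h (z i) = q (z i) (z (Suc i)) * (z (Suc i) - z i)"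
      using z(2)[OF i] by (simp add: q_def)
    then show "(h (z (Suc i)) - h (z i)) powr (e - 1) = exp ((e - 1) * ln (q (z i) (z (Suc i)))) * (z (Suc i) - z i) powr (e - 1)"
      using z(2)[OF i] qz[OF i] by (simp add: powr_mult) (simp add: powr_def)
  qed
  also have "\<dots> = exp (\<Sum>i\<le>N. (e - 1) * ln (q (z i) (z (Suc i)))) * (\<Prod>i\<le>N. (z (Suc i) - z i) powr (e - 1))"
    by (simp add: prod.distrib exp_sum)
  finally have 1: "(\<Prod>i\<le>N. (h (z (Suc i)) - h (z i)) powr (e - 1)) = \<dots>" .
  have 2: "(\<Prod>i\<in>{1..N}. h' (z i)) = exp (\<Sum>i\<in>{1..N}. ln (h' (z i)))"
    using h'z by (subst exp_sum) (auto intro!: prod.cong)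
  have 3: "1 / sqrt (h' (z 0) * h' (z (Suc N))) = exp (- (ln (h' (z 0)) + ln (h' (z (Suc N)))) / 2)"
  proof -
    have "ln (sqrt (h' (z 0) * h' (z (Suc N)))) = (ln (h' (z 0)) + ln (h' (z (Suc N)))) / 2"
      using h'z[of 0] h'z[of "Suc N"] by (simp add: ln_sqrt ln_mult)
    moreover have "0 < sqrt (h' (z 0) * h' (z (Suc N)))"
      using h'z[of 0] h'z[of "Suc N"] by simp
    ultimately show ?thesis
      by (simp only: exp_minus minus_divide_left[symmetric] exp_ln inverse_eq_divide flip: \<open>ln _ = _\<close>)
  qed
  have s1: "(\<Sum>i\<le>N. ln (h' (z i))) = ln (h' (z 0)) + (\<Sum>i\<in>{1..N}. ln (h' (z i)))"
    by (simp add: sum.atMost_shift sum.atLeast_Suc_atMost_Suc_shift atLeast0LessThan[symmetric] sum.atLeast1_atMost_eq)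
  have s2: "(\<Sum>i\<le>N. ln (h' (z (Suc i)))) = (\<Sum>i\<in>{1..N}. ln (h' (z i))) + ln (h' (z (Suc N)))"
    by (simp add: sum.atLeast1_atMost_eq lessThan_Suc_atMost[symmetric])
  have "(\<Sum>i\<le>N. phi (z i) (z (Suc i))) =
      ((\<Sum>i\<le>N. ln (h' (z i))) + (\<Sum>i\<le>N. ln (h' (z (Suc i))))) / 2 - (\<Sum>i\<le>N. ln (q (z i) (z (Suc i))))"
    by (simp add: phi_def sum_subtractf sum.distrib flip: sum_divide_distrib)
  \<comment> \<open>Here \<open>Lq\<close> is the sum of all \<open>ln q\<close>, \<open>S\<close>
    the sum of \<open>ln (h' z)\<close> over interior points, and \<open>a\<close>, \<open>b\<close>
    are its two boundary values.\<close>
  moreover have "(e - 1) * Lq + S = e * Lq + P + - (a + b) / 2" if "P = ((a + S) + (S + b)) / 2 - Lq"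
    for Lq S P a b :: real
    using that by (simp add: field_simps)
  ultimately have "(\<Sum>i\<le>N. (e - 1) * ln (q (z i) (z (Suc i)))) + (\<Sum>i\<in>{1..N}. ln (h' (z i))) =
      e * (\<Sum>i\<le>N. ln (q (z i) (z (Suc i)))) + (\<Sum>i\<le>N. phi (z i) (z (Suc i)))
      + - (ln (h' (z 0)) + ln (h' (z (Suc N)))) / 2"
    unfolding s1 s2 sum_distrib_left[symmetric] by blast
  then have "exp (\<Sum>i\<le>N. (e - 1) * ln (q (z i) (z (Suc i)))) * exp (\<Sum>i\<in>{1..N}. ln (h' (z i))) =
      exp (e * (\<Sum>i\<le>N. ln (q (z i) (z (Suc i)))) + (\<Sum>i\<le>N. phi (z i) (z (Suc i))))
      * (1 / sqrt (h' (z 0) * h' (z (Suc N))))"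
    unfolding 3 by (simp only: exp_add[symmetric])
  moreover have "a * p * b = p * (c / s)" if "a * b = c * (1 / s)" for a b c p s :: real
    using that by (metis mult.assoc mult.commute mult.right_neutral times_divide_eq_right)
  ultimately show ?thesis unfolding 1 2 by blast
qed

lemma dirichlet_density_change:
  assumes y: "\<And>i. i \<in> {1..N} \<Longrightarrow> 0 \<le> y i \<and> y i \<le> 1"
  defines "t \<equiv> \<lambda>i. real i / real (Suc N)"
  shows "dirichlet_fdd_density \<beta> N t (\<lambda>i\<in>{1..N}. h (clamp01 (y i))) * (\<Prod>i\<in>{1..N}. h' (y i)) =
    dirichlet_fdd_density \<beta> N t y * grid_density \<beta> N y"
proof -
  define w where "w = (\<lambda>i\<in>{1..N}. h (clamp01 (y i)))"
  define z where "z = ext01 N y"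
  have z: "0 \<le> z i \<and> z i \<le> 1" if "i \<le> Suc N" for i
    using y that by (auto simp: z_def ext01_def)
  have hz: "ext01 N w i = h (z i)" if "i \<le> Suc N" for i
    using y that by (auto simp: w_def z_def ext01_def clamp01_id)
  have incr: "(\<forall>i\<le>N. ext01 N w i < ext01 N w (i + 1)) \<longleftrightarrow>
      (\<forall>i\<le>N. z i < z (Suc i))"
  proof -
    have "ext01 N w i < ext01 N w (i + 1) \<longleftrightarrow>
        z i < z (Suc i)" if "i \<le> N" for i
    proof -
      have i: "i \<le> Suc N" "Suc i \<le> Suc N" using that by auto
      show ?thesis
        unfolding Suc_eq_plus1[symmetric] hz[OF i(1)] hz[OF i(2)]
        using z[OF i(1)] z[OF i(2)] by (simp add: h_less_iff)
    qed
    then show ?thesis by blast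
  qed
  \<comment> \<open>On an equidistant grid all Dirichlet exponents coincide; this is the
    \<open>e\<close> of \<open>prod_powr_telescope\<close>, and it makes the \<open>ln q\<close>
    terms an average times \<open>\<beta>\<close>.\<close>
  have e: "\<beta> * (ext01 N t (Suc i) - ext01 N t i) = \<beta> / real (Suc N)" if "i \<le> N" for i
    using that unfolding t_def by (simp only: ext01_grid le_SucI Suc_le_mono)
      (simp add: diff_divide_distrib[symmetric])
  show ?thesis
  proof (cases "\<forall>i\<le>N. z i < z (Suc i)")
    case False
    then have "dirichlet_fdd_density \<beta> N t w = 0" "dirichlet_fdd_density \<beta> N t y = 0"
      using incr unfolding dirichlet_fdd_density_def z_def by (auto intro!: if_not_P)
    then show ?thesis unfolding w_def[symmetric] by simp
  next
    case True
    define G where "G = Gamma \<beta> / (\<Prod>i\<le>N. Gamma (\<beta> * (ext01 N t (i + 1) - ext01 N t i)))"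
    have "dirichlet_fdd_density \<beta> N t w =
        G * (\<Prod>i\<le>N. (h (z (Suc i)) - h (z i)) powr (\<beta> / real (Suc N) - 1))"
      using True incr unfolding dirichlet_fdd_density_def G_def
      by (auto simp: hz e intro!: prod.cong)
    moreover have "dirichlet_fdd_density \<beta> N t y =
        G * (\<Prod>i\<le>N. (z (Suc i) - z i) powr (\<beta> / real (Suc N) - 1))"
      using True unfolding dirichlet_fdd_density_def G_def z_def
      by (auto simp: e intro!: prod.cong)
    moreover have "(\<Prod>i\<in>{1..N}. h' (y i)) = (\<Prod>i\<in>{1..N}. h' (z i))"
      by (intro prod.cong) (auto simp: z_def ext01_def)
    moreover have "grid_density \<beta> N y = exp (\<beta> / real (Suc N) * (\<Sum>i\<le>N. ln (q (z i) (z (Suc i)))) + (\<Sum>i\<le>N. phi (z i) (z (Suc i))))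
      / sqrt (h' (z 0) * h' (z (Suc N)))"
    proof -
      have "clamp01 (ext01 N y i) = z i" if "i \<le> Suc N" for i
        using z[OF that] by (simp add: z_def clamp01_id)
      moreover have "z 0 = 0" "z (Suc N) = 1" by (auto simp: z_def ext01_def)
      ultimately show ?thesis
        by (simp add: grid_density_def lessThan_Suc_atMost sum_divide_distrib[symmetric])
    qed
    ultimately show ?thesis
      using prod_powr_telescope[of N z "\<beta> / real (Suc N)"] z True
      unfolding w_def[symmetric] by (simp only: mult.assoc)
  qed
qed

lemma grid_density_pos: "0 < grid_density \<beta> N y"
  using h'_pos[of 0] h'_pos[of 1] by (simp add: grid_density_def)

text \<open>Substituting \<open>x i = h (y i)\<close> in the Dirichlet integral undoes
  \<open>k\<close> inside \<open>U\<close>, and \<open>dirichlet_density_change\<close> supplies the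
  resulting density.\<close>

lemma fdd_translation:
  assumes Q: "is_Q0 \<beta> Q" and U[measurable]: "U \<in> borel_measurable (Pi\<^sub>M {1..N} (\<lambda>_. lborel))"
  defines "t \<equiv> \<lambda>i. real i / real (Suc N)"
  shows "(\<integral>\<^sup>+g. U (\<lambda>i\<in>{1..N}. k (g (t i))) \<partial>Q) =
    (\<integral>\<^sup>+g. ennreal (grid_density \<beta> N (\<lambda>i\<in>{1..N}. g (t i))) * U (\<lambda>i\<in>{1..N}. g (t i)) \<partial>Q)"
proof -
  let ?P = "Pi\<^sub>M {1..N} (\<lambda>_. lborel :: real measure)"
  let ?\<rho> = "dirichlet_fdd_density \<beta> N t"
  have t: "ext01 N t i < ext01 N t (Suc i)" if "i \<le> N" for i
    using that unfolding t_def by (simp only: ext01_grid le_SucI Suc_le_mono) (simp add: divide_strict_right_mono)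
  \<comment> \<open>The Dirichlet density vanishes unless the coordinates increase from 0 to 1,
    which is the support condition for the change of variables.\<close>
  have \<rho>0: "?\<rho> x = 0" if "i \<in> {1..N}" "x i \<notin> {0..1}" for x i
  proof (rule ccontr)
    assume "?\<rho> x \<noteq> 0"
    then have *: "ext01 N x i < ext01 N x (Suc i)" if "i \<le> N" for i
      using that by (auto simp: dirichlet_fdd_density_def split: if_splits)
    have "ext01 N x i \<le> ext01 N x j" if "i \<le> j" "j \<le> Suc N" for i j
      using that(1) that(2) by (induction rule: dec_induct) (use * in \<open>auto intro: less_imp_le order_trans\<close>)
    from this[of 0 i] this[of i "Suc N"] show False
      using that by (auto simp: ext01_def split: if_splits)
  qed
  have "(\<lambda>x. \<lambda>i\<in>{1..N}. k (clamp01 (x i))) \<in> measurable ?P ?P"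
    by (intro measurable_restrict) 
      (auto intro!: measurable_compose[OF _ measurable_clamp_k])
  then have kU[measurable]: "(\<lambda>x. U (\<lambda>i\<in>{1..N}. k (clamp01 (x i)))) \<in> borel_measurable ?P"
    by (rule measurable_compose[OF _ U])
  have "(\<integral>\<^sup>+g. U (\<lambda>i\<in>{1..N}. k (g (t i))) \<partial>Q) =
      (\<integral>\<^sup>+g. U (\<lambda>i\<in>{1..N}. k (clamp01 ((\<lambda>i\<in>{1..N}. g (t i)) i))) \<partial>Q)"
    using G0_range by (intro nn_integral_cong arg_cong[where f=U] restrict_ext)
      (simp add: is_Q0D(3)[OF Q] clamp01_id)
  also have "\<dots> = (\<integral>\<^sup>+x. ennreal (?\<rho> x) * U (\<lambda>i\<in>{1..N}. k (clamp01 (x i))) \<partial>?P)"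
    using t by (rule nn_integral_fdd[OF Q _ kU])
  also have "\<dots> = (\<integral>\<^sup>+y. (\<Prod>i\<in>{1..N}. dens01 (y i)) * (ennreal (?\<rho> (\<lambda>i\<in>{1..N}. h (clamp01 (y i)))) *
      U (\<lambda>i\<in>{1..N}. k (clamp01 ((\<lambda>i\<in>{1..N}. h (clamp01 (y i))) i)))) \<partial>?P)"
  proof (rule nn_integral_PiM_change_of_variables)
    show "(\<lambda>x. ennreal (?\<rho> x) * U (\<lambda>i\<in>{1..N}. k (clamp01 (x i)))) \<in> borel_measurable ?P"
      by measurable
    show "ennreal (?\<rho> x) * U (\<lambda>i\<in>{1..N}. k (clamp01 (x i))) = 0" if "i \<in> {1..N}" "x i \<notin> {0..1}" for x i
      using \<rho>0[of i x] that by simp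
  qed simp
  also have "\<dots> = (\<integral>\<^sup>+y. ennreal (?\<rho> y) * (ennreal (grid_density \<beta> N y) * U y) \<partial>?P)"
  proof (rule nn_integral_cong)
    fix y assume y: "y \<in> space ?P"
    show "(\<Prod>i\<in>{1..N}. dens01 (y i)) * (ennreal (?\<rho> (\<lambda>i\<in>{1..N}. h (clamp01 (y i)))) *
        U (\<lambda>i\<in>{1..N}. k (clamp01 ((\<lambda>i\<in>{1..N}. h (clamp01 (y i))) i)))) =
        ennreal (?\<rho> y) * (ennreal (grid_density \<beta> N y) * U y)"
    proof (cases "\<forall>i\<in>{1..N}. y i \<in> {0..1}")
      case False
      then obtain i where i: "i \<in> {1..N}" "y i \<notin> {0..1}" by blast
      then have "dens01 (y i) = 0" by (simp add: dens01_def)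
      then have "(\<Prod>i\<in>{1..N}. dens01 (y i)) = 0" using i by (intro prod_zero) auto
      then show ?thesis using \<rho>0[of i y] i by simp
    next
      case True
      then have y01: "\<And>i. i \<in> {1..N} \<Longrightarrow> 0 \<le> y i \<and> y i \<le> 1" by auto
      have "(\<lambda>i\<in>{1..N}. k (clamp01 ((\<lambda>i\<in>{1..N}. h (clamp01 (y i))) i))) = (\<lambda>i\<in>{1..N}. y i)"
        using y01 h_range by (intro restrict_ext) (simp add: clamp01_id k_h)
      also have "\<dots> = y"
        using y by (auto simp: space_PiM extensional_restrict PiE_def)
      finally have 1: "(\<lambda>i\<in>{1..N}. k (clamp01 ((\<lambda>i\<in>{1..N}. h (clamp01 (y i))) i))) = y" .
      have h'y: "0 \<le> h' (y i)" if "i \<in> {1..N}" for i using h'_pos[of "y i"] y01[OF that] by simp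
      have "(\<Prod>i\<in>{1..N}. dens01 (y i)) = (\<Prod>i\<in>{1..N}. ennreal (h' (y i)))"
        using y01 by (intro prod.cong) (auto simp: dens01_def clamp01_id)
      also have "\<dots> = ennreal (\<Prod>i\<in>{1..N}. h' (y i))"
        using h'y by (rule prod_ennreal)
      finally have "(\<Prod>i\<in>{1..N}. dens01 (y i)) * ennreal (?\<rho> (\<lambda>i\<in>{1..N}. h (clamp01 (y i)))) =
          ennreal (?\<rho> (\<lambda>i\<in>{1..N}. h (clamp01 (y i))) * (\<Prod>i\<in>{1..N}. h' (y i)))"
        using h'y by (subst ennreal_mult'') (auto intro: prod_nonneg simp: mult.commute)
      also have "\<dots> = ennreal (?\<rho> y) * ennreal (grid_density \<beta> N y)"
        using grid_density_pos[of \<beta> N y] dirichlet_density_change[OF y01, where \<beta>=\<beta>]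
        by (simp add: ennreal_mult'' t_def less_imp_le)
      finally show ?thesis unfolding 1 by (simp only: mult.assoc[symmetric])
    qed
  qed
  also have "\<dots> = (\<integral>\<^sup>+g. ennreal (grid_density \<beta> N (\<lambda>i\<in>{1..N}. g (t i))) * U (\<lambda>i\<in>{1..N}. g (t i)) \<partial>Q)"
  proof (rule nn_integral_fdd[OF Q, symmetric])
    show "(\<lambda>x. ennreal (grid_density \<beta> N x) * U x) \<in> borel_measurable ?P" by measurable
  qed (rule t)
  finally show ?thesis .
qed

end

section \<open>Passage to the limit\<close>

text \<open>The grid points approach \<open>s\<close> from the right, so the bound \<open>g s < c\<close> passes to them by right
  continuity and its negation by monotonicity. This is why strict upper bounds are chosen below as
  generators of the \<open>\<sigma>\<close>-algebra: no continuous test functions are needed.\<close>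

lemma eventually_ceiling_grid_less:
  assumes g: "g \<in> G0"
  shows "\<forall>\<^sub>F n in sequentially. g (real_of_int \<lceil>real n * s\<rceil> / real n) < c \<longleftrightarrow> g s < c"
proof -
  consider "s < 0" | "0 \<le> s" "g s < c" | "0 \<le> s" "c \<le> g s" by linarith
  then show ?thesis
  proof cases
    case 1
    have "\<forall>\<^sub>F n in sequentially. real_of_int \<lceil>real n * s\<rceil> / real n < 0"
      using order_tendstoD(2)[OF ceiling_grid_tendsto 1] .
    then show ?thesis
      by eventually_elim (use 1 g in \<open>simp add: G0_outside\<close>)
  next
    case 2
    show ?thesis
      using order_tendstoD(2)[OF G0_ceiling_grid[OF g 2(1)] 2(2)]
      by eventually_elim (use 2 in simp)
  next
    case 3
    show ?thesis
      using eventually_gt_at_top[of "0::nat"]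
    proof eventually_elim
      case (elim n)
      then have "s \<le> real_of_int \<lceil>real n * s\<rceil> / real n"
        using ceiling_correct[of "real n * s"] by (simp add: field_simps)
      then show ?case using G0_mono[OF g 3(1)] 3(2) by (auto simp: not_less intro: order_trans)
    qed
  qed
qed

lemma sets_Collect_ball_less:
  fixes f :: "'i \<Rightarrow> 'a \<Rightarrow> real"
  assumes "finite J" "\<And>s. s \<in> J \<Longrightarrow> f s \<in> borel_measurable M"
  shows "{x \<in> space M. \<forall>s\<in>J. f s x < c s} \<in> sets M"
  using assms by (intro sets.sets_Collect_finite_All borel_measurable_less) auto

text \<open>Finite \<open>J\<close> makes the generator closed under intersection. For the inclusion
  of \<open>sets G0M\<close>, the identity is shown measurable into \<open>G0M\<close>, which only
  requires single coordinates, that is, singletons \<open>J\<close>.\<close>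

lemma sets_G0M_eq:
  "sets G0M = sigma_sets G0 {{g \<in> G0. \<forall>s\<in>J. g s < c s} |J c. finite J}" (is "_ = sigma_sets G0 ?E")
proof
  have spG: "space G0M = G0" by (simp add: G0M_def space_restrict_space space_PiM)
  have E: "?E \<subseteq> Pow G0" by auto
  show "sigma_sets G0 ?E \<subseteq> sets G0M"
  proof -
    have "X \<in> sets G0M" if XE: "X \<in> ?E" for X
    proof -
      obtain J c where X: "X = {g \<in> G0. \<forall>s\<in>J. g s < c s}" "finite J" using XE by blast
      have "{g \<in> space G0M. \<forall>s\<in>J. g s < c s} \<in> sets G0M"
        using X(2) by (rule sets_Collect_ball_less) (rule measurable_G0M_eval)
      then show ?thesis by (simp add: X(1) spG)
    qed
    then show ?thesis using sets.sigma_sets_subset[of ?E G0M] by (auto simp: spG)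
  qed
  have "(\<lambda>g. g) \<in> measurable (sigma G0 ?E) G0M"
    unfolding G0M_def
  proof (rule measurable_restrict_space2)
    show "(\<lambda>g. g) \<in> space (sigma G0 ?E) \<rightarrow> G0" using E by (simp add: space_measure_of)
    have "(\<lambda>g x. g x) \<in> measurable (sigma G0 ?E) (Pi\<^sub>M UNIV (\<lambda>_. borel :: real measure))"
    proof (rule measurable_PiM_single')
      fix s :: real
      show "(\<lambda>g. g s) \<in> borel_measurable (sigma G0 ?E)"
      proof (rule borel_measurableI_less)
        fix y :: real
        have "{g \<in> G0. g s < y} \<in> ?E"
          by (rule CollectI, rule exI[of _ "{s}"], rule exI[of _ "\<lambda>_. y"]) auto
        then show "{g \<in> space (sigma G0 ?E). g s < y} \<in> sets (sigma G0 ?E)"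
          using E by (simp add: space_measure_of sets_measure_of)
      qed
    qed auto
    then show "(\<lambda>g. g) \<in> measurable (sigma G0 ?E) (Pi\<^sub>M UNIV (\<lambda>_. borel :: real measure))" by simp
  qed
  note id = this
  show "sets G0M \<subseteq> sigma_sets G0 ?E"
  proof
    fix X assume X: "X \<in> sets G0M"
    have "X \<inter> G0 = X" using sets.sets_into_space[OF X] by (auto simp: spG)
    then show "X \<in> sigma_sets G0 ?E"
      using measurable_sets[OF id X] E by (simp add: space_measure_of sets_measure_of)
  qed
qed

context C2_iso01
begin

section \<open>The translation on path space\<close>

lemma k_comp_G0:
  assumes g: "g \<in> G0"
  shows "k \<circ> g \<in> G0"
  unfolding G0_def
proof (intro CollectI conjI ballI allI impI)
  fix t
  show "(k \<circ> g) t \<in> {0..1}" using k_range G0_range[OF g] by simp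
  show "mono_on {0..<1} (k \<circ> g)"
    using G0_mono[OF g] G0_range[OF g] by (intro mono_onI) (auto intro: k_mono)
  show "(k \<circ> g) t = 1" if "t \<notin> {0..<1}"
    using that G0_outside[OF g, of t] by auto
  show "continuous (at_right t) (k \<circ> g)" if "t \<in> {0..<1}"
  proof -
    have "(g \<longlongrightarrow> g t) (at_right t)" using that by (intro G0_right_cont[OF g]) auto
    then have "((\<lambda>s. k (g s)) \<longlongrightarrow> k (g t)) (at_right t)"
      using G0_range[OF g] by (intro continuous_on_tendsto_compose[OF cont_k]) auto
    then show ?thesis by (simp add: continuous_within o_def)
  qed
qed

lemma measurable_k_comp: "(\<lambda>g. k \<circ> g) \<in> measurable G0M G0M"
proof -
  have spG: "space G0M = G0" by (simp add: G0M_def space_restrict_space space_PiM)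
  have "(\<lambda>g s. k (g s)) \<in> measurable G0M (Pi\<^sub>M UNIV (\<lambda>_. borel))"
  proof (rule measurable_PiM_single')
    fix s
    have "(\<lambda>g. k (clamp01 (g s))) \<in> borel_measurable G0M"
      by (rule measurable_compose[OF measurable_G0M_eval measurable_clamp_k])
    also have "?this \<longleftrightarrow> (\<lambda>g. k (g s)) \<in> borel_measurable G0M"
      using G0_range by (intro measurable_cong) (simp add: spG clamp01_id)
    finally show "(\<lambda>g. k (g s)) \<in> borel_measurable G0M" .
  qed auto
  then show ?thesis
    unfolding o_def using k_comp_G0 spG
    by (subst (2) G0M_def) (auto intro!: measurable_restrict_space2 simp: o_def)
qed

text \<open>Boundedness of \<open>psi\<close> gives
  \<open>\<bar>phi x y\<bar> \<le> L * (y - x)\<close>. Grid increments telescope to at most 1 and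
  jump heights sum to at most 1, so the same \<open>L\<close> serves the grid sums and the jump
  sum.\<close>

lemma Phi_grid_bound: obtains L where "\<And>n g. g \<in> G0 \<Longrightarrow> \<bar>Phi_grid n g\<bar> \<le> L"
  and "\<And>g. g \<in> G0 \<Longrightarrow> \<bar>\<Sum>\<^sub>\<infinity>a\<in>jumps g. ln (jump_factor h h' g a)\<bar> \<le> L"
proof -
  obtain L where L: "0 \<le> L" "\<And>x y. 0 \<le> x \<Longrightarrow> x \<le> y \<Longrightarrow> y \<le> 1 \<Longrightarrow> \<bar>psi x y\<bar> \<le> L"
    using psi_bound by blast
  have phi_le: "\<bar>phi x y\<bar> \<le> L * (y - x)" if "0 \<le> x" "x \<le> y" "y \<le> 1" for x y
  proof -
    have "\<bar>phi x y\<bar> = (y - x) * \<bar>psi x y\<bar>"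
      using that by (simp add: abs_mult flip: psi_eq_phi(2))
    also have "\<dots> \<le> (y - x) * L" using that L by (intro mult_left_mono) auto
    finally show ?thesis by (simp add: mult.commute)
  qed
  have 1: "\<bar>Phi_grid n g\<bar> \<le> L" if g: "g \<in> G0" for n g
  proof -
    have "\<bar>Phi_grid n g\<bar> \<le> (\<Sum>i<n. \<bar>phi (g (real i / real n)) (g (real (Suc i) / real n))\<bar>)"
      unfolding Phi_grid_def by (rule sum_abs)
    also have "\<dots> \<le> (\<Sum>i<n. L * (g (real (Suc i) / real n) - g (real i / real n)))"
      using G0_range[OF g] by (intro sum_mono phi_le G0_mono[OF g]) (auto intro: divide_right_mono)
    also have "\<dots> = L * (g (real n / real n) - g (real 0 / real n))"
      unfolding sum_distrib_left[symmetric] 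
      by (subst sum_lessThan_telescope[of "\<lambda>i. g (real i / real n)"]) simp
    also have "\<dots> \<le> L * 1"
      using L G0_range[OF g, of "real n / real n"] G0_range[OF g, of "real 0 / real n"]
      by (intro mult_left_mono) linarith+
    finally show ?thesis by simp
  qed
  have 2: "\<bar>\<Sum>\<^sub>\<infinity>a\<in>jumps g. ln (jump_factor h h' g a)\<bar> \<le> L" if g: "g \<in> G0" for g
  proof -
    have j: "\<bar>phi (left_lim g a) (g a)\<bar> \<le> L * (g a - left_lim g a)" if "a \<in> jumps g" for a
      using that left_lim_range[OF g, of a] G0_range[OF g, of a] G0_left_lim(3)[OF g, of a]
      by (intro phi_le) (auto simp: jumps_def)
    have s: "(\<lambda>a. L * (g a - left_lim g a)) summable_on jumps g"
      by (intro summable_on_cmult_right G0_jumps_summable g)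
    then have abs: "(\<lambda>a. norm (phi (left_lim g a) (g a))) summable_on jumps g"
      by (rule summable_on_comparison_test) (use j in auto)
    have "\<bar>\<Sum>\<^sub>\<infinity>a\<in>jumps g. ln (jump_factor h h' g a)\<bar> = norm (\<Sum>\<^sub>\<infinity>a\<in>jumps g. phi (left_lim g a) (g a))"
      using ln_jump_factor[OF g] by (simp cong: infsum_cong)
    also have "\<dots> \<le> (\<Sum>\<^sub>\<infinity>a\<in>jumps g. norm (phi (left_lim g a) (g a)))"
      using abs by (rule norm_infsum_bound)
    also have "\<dots> \<le> (\<Sum>\<^sub>\<infinity>a\<in>jumps g. L * (g a - left_lim g a))"
      using abs s by (rule infsum_mono) (use j in auto)
    also have "\<dots> = L * (\<Sum>\<^sub>\<infinity>a\<in>jumps g. g a - left_lim g a)"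
      by (rule infsum_cmult_right') 
    also have "\<dots> \<le> L * 1"
      using L G0_jumps_summable(2)[OF g] by (intro mult_left_mono) auto
    finally show ?thesis by simp
  qed
  show thesis using that 1 2 by blast
qed

lemma Lam_grid_bound: obtains M where "\<And>n g. g \<in> G0 \<Longrightarrow> \<bar>Lam_grid n g\<bar> \<le> M"
  and "\<And>g. g \<in> G0 \<Longrightarrow> \<bar>integral {0..1} (\<lambda>s. ln (h' (g s)))\<bar> \<le> M"
proof -
  obtain M where M: "0 \<le> M" "\<And>x y. 0 \<le> x \<Longrightarrow> x \<le> y \<Longrightarrow> y \<le> 1 \<Longrightarrow> \<bar>ln (q x y)\<bar> \<le> M"
    using ln_q_bound by blast
  have 1: "\<bar>Lam_grid n g\<bar> \<le> M" if g: "g \<in> G0" for n g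
  proof -
    have "\<bar>Lam_grid n g\<bar> \<le> (\<Sum>i<n. \<bar>ln (q (g (real i / real n)) (g (real (Suc i) / real n))) / real n\<bar>)"
      unfolding Lam_grid_def by (rule sum_abs)
    also have "\<dots> \<le> (\<Sum>i<n. M / real n)"
      using G0_range[OF g] 
      by (intro sum_mono) (simp only: abs_divide abs_of_nat, intro divide_right_mono M G0_mono[OF g], auto intro: divide_right_mono)
    also have "\<dots> \<le> M" using M(1) by simp
    finally show ?thesis .
  qed
  moreover have "\<bar>integral {0..1} (\<lambda>s. ln (h' (g s)))\<bar> \<le> M" if g: "g \<in> G0" for g
    using tendsto_rabs[OF tendsto_Lam_grid[OF g]] 1[OF g] by (intro LIMSEQ_le_const2) auto
  ultimately show thesis using that by blast
qed

definition grid_Y :: "real \<Rightarrow> nat \<Rightarrow> (real \<Rightarrow> real) \<Rightarrow> real" where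
  "grid_Y \<beta> n g = exp (\<beta> * Lam_grid n g + Phi_grid n g) / sqrt (h' 0 * h' 1)"

text \<open>\<open>ext01\<close> prescribes 0 and 1 at the ends; the path matches by the assumption
  \<open>g 0 = 0\<close> and by the convention \<open>g 1 = 1\<close>.\<close>

lemma grid_density_eq_grid_Y:
  assumes g: "g \<in> G0" "g 0 = 0"
  shows "grid_density \<beta> N (\<lambda>i\<in>{1..N}. g (real i / real (Suc N))) = grid_Y \<beta> (Suc N) g"
proof -
  define y where "y = (\<lambda>i\<in>{1..N}. g (real i / real (Suc N)))"
  have "clamp01 (ext01 N y i) = g (real i / real (Suc N))" if "i \<le> Suc N" for i
    using that g G0_range[OF g(1)] G0_outside[OF g(1), of 1] by (auto simp: y_def ext01_def clamp01_id)
  then show ?thesis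
    unfolding y_def[symmetric]
    by (simp add: grid_density_def grid_Y_def Lam_grid_def Phi_grid_def del: sum.lessThan_Suc of_nat_Suc cong: sum.cong_simp)
qed

lemma tendsto_grid_Y:
  assumes "g \<in> G0" "g 0 = 0" "\<forall>y<1. \<exists>t. 0 \<le> t \<and> t < 1 \<and> y < g t"
  shows "(\<lambda>n. grid_Y \<beta> n g) \<longlonglongrightarrow> Yb0 \<beta> h h' g"
proof -
  have "0 < h' 0 * h' 1" using h'_pos[of 0] h'_pos[of 1] by simp
  then have "(\<lambda>n. grid_Y \<beta> n g) \<longlonglongrightarrow> exp (\<beta> * integral {0..1} (\<lambda>s. ln (h' (g s))) +
      (\<Sum>\<^sub>\<infinity>a\<in>jumps g. ln (jump_factor h h' g a))) / sqrt (h' 0 * h' 1)"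
    unfolding grid_Y_def using assms
    by (intro tendsto_intros tendsto_Lam_grid tendsto_Phi_grid) auto
  then show ?thesis
    by (simp add: Yb0_def Xb_def Y0_def exp_add)
qed

lemma exp_div_sqrt_bounds:
  assumes "0 < \<beta>" "\<bar>l\<bar> \<le> M" "\<bar>p\<bar> \<le> L"
  shows "exp (- (\<beta> * M + L)) / sqrt (h' 0 * h' 1) \<le> exp (\<beta> * l + p) / sqrt (h' 0 * h' 1)"
    "exp (\<beta> * l + p) / sqrt (h' 0 * h' 1) \<le> exp (\<beta> * M + L) / sqrt (h' 0 * h' 1)"
proof -
  have "\<beta> * \<bar>l\<bar> \<le> \<beta> * M" using assms by (intro mult_left_mono) auto
  then have "\<bar>\<beta> * l\<bar> \<le> \<beta> * M" using assms by (simp add: abs_mult)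
  then have "- (\<beta> * M + L) \<le> \<beta> * l + p" "\<beta> * l + p \<le> \<beta> * M + L" using assms by linarith+
  then show "exp (- (\<beta> * M + L)) / sqrt (h' 0 * h' 1) \<le> exp (\<beta> * l + p) / sqrt (h' 0 * h' 1)"
    "exp (\<beta> * l + p) / sqrt (h' 0 * h' 1) \<le> exp (\<beta> * M + L) / sqrt (h' 0 * h' 1)"
    using h'_pos[of 0] h'_pos[of 1] by (auto intro!: divide_right_mono)
qed

lemma Yb0_bounds:
  assumes "0 < \<beta>"
  shows "\<exists>c C. 0 < c \<and> (\<forall>g\<in>G0. c \<le> Yb0 \<beta> h h' g \<and> Yb0 \<beta> h h' g \<le> C)"
proof -
  obtain L where L: "\<And>g. g \<in> G0 \<Longrightarrow> \<bar>\<Sum>\<^sub>\<infinity>a\<in>jumps g. ln (jump_factor h h' g a)\<bar> \<le> L"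
    using Phi_grid_bound by metis
  obtain M where M: "\<And>g. g \<in> G0 \<Longrightarrow> \<bar>integral {0..1} (\<lambda>s. ln (h' (g s)))\<bar> \<le> M"
    using Lam_grid_bound by metis
  have "Yb0 \<beta> h h' g = exp (\<beta> * integral {0..1} (\<lambda>s. ln (h' (g s))) +
      (\<Sum>\<^sub>\<infinity>a\<in>jumps g. ln (jump_factor h h' g a))) / sqrt (h' 0 * h' 1)" for g
    by (simp add: Yb0_def Xb_def Y0_def exp_add)
  moreover have "0 < exp (- (\<beta> * M + L)) / sqrt (h' 0 * h' 1)"
    using h'_pos[of 0] h'_pos[of 1] by simp
  ultimately show ?thesis
    using exp_div_sqrt_bounds[OF assms M L] by (intro exI[of _ "exp (- (\<beta> * M + L)) / sqrt (h' 0 * h' 1)"] exI) auto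
qed

section \<open>Identification of the translated law\<close>

lemma measurable_grid_Y:
  assumes Q: "is_Q0 \<beta>' Q"
  shows "grid_Y \<beta> n \<in> borel_measurable Q"
proof -
  note [measurable] = measurable_is_Q0_eval[OF Q]
  have "(\<lambda>g. exp (\<beta> * (\<Sum>i<n. ln (q (clamp01 (g (real i / real n))) (clamp01 (g (real (Suc i) / real n)))) / real n) +
      (\<Sum>i<n. phi (clamp01 (g (real i / real n))) (clamp01 (g (real (Suc i) / real n))))) / sqrt (h' 0 * h' 1))
      \<in> borel_measurable Q"
    by measurable
  also have "?this \<longleftrightarrow> ?thesis"
    using G0_range by (intro measurable_cong)
      (simp add: is_Q0D(3)[OF Q] clamp01_id grid_Y_def Lam_grid_def Phi_grid_def)
  finally show ?thesis .
qed

text \<open>\<open>fdd_translation\<close> applied to the indicator of an event that depends on the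
  path only through its values on the grid.\<close>

lemma grid_translation:
  assumes \<beta>: "0 < \<beta>" and Q: "is_Q0 \<beta> Q" and J: "finite J"
  shows "emeasure Q {g \<in> space Q. \<forall>s\<in>J. k (g (real_of_int \<lceil>real (Suc N) * s\<rceil> / real (Suc N))) < c s} =
    (\<integral>\<^sup>+g. ennreal (grid_Y \<beta> (Suc N) g) *
      indicator {g. \<forall>s\<in>J. g (real_of_int \<lceil>real (Suc N) * s\<rceil> / real (Suc N)) < c s} g \<partial>Q)"
proof -
  \<comment> \<open>Since \<open>s\<close> ranges over all reals, any integer index can occur: 0
    stands for the value 0, indices up to \<open>N\<close> read a coordinate, and all others give
    the value 1 of paths outside \<open>{0..<1}\<close>.\<close>
  define w where "w = (\<lambda>(x :: nat \<Rightarrow> real) (i :: int). if i = 0 then 0 else if 1 \<le> i \<and> i \<le> int N then x (nat i) else 1)"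
  have [measurable]: "(\<lambda>x. w x i) \<in> borel_measurable (Pi\<^sub>M {1..N} (\<lambda>_. lborel))" for i
  proof (cases "1 \<le> i \<and> i \<le> int N")
    case True
    then have "nat i \<in> {1..N}" by auto
    then show ?thesis using True by (simp add: w_def)
  next
    case False
    then have "w x i = (if i = 0 then 0 else 1)" for x unfolding w_def by auto
    then show ?thesis by simp
  qed
  define U where "U = (\<lambda>x. indicator {x. \<forall>s\<in>J. w x \<lceil>real (Suc N) * s\<rceil> < c s} x :: ennreal)"
  have "{x \<in> space (Pi\<^sub>M {1..N} (\<lambda>_. lborel)). \<forall>s\<in>J. w x \<lceil>real (Suc N) * s\<rceil> < c s} \<in> sets (Pi\<^sub>M {1..N} (\<lambda>_. lborel))"
    using J by (rule sets_Collect_ball_less) measurable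
  then have U: "U \<in> borel_measurable (Pi\<^sub>M {1..N} (\<lambda>_. lborel))"
    unfolding U_def by (subst borel_measurable_indicator_iff) (simp add: Int_def conj_commute)
  have w: "f (real_of_int i / real (Suc N)) = w (\<lambda>i\<in>{1..N}. f (real i / real (Suc N))) i"
    if f: "f \<in> G0" "f 0 = 0" for f i
  proof -
    consider "i = 0" | "1 \<le> i" "i \<le> int N" | "i < 0" | "int N < i" by linarith
    then show ?thesis
    proof cases
      case 1
      then show ?thesis using f by (simp add: w_def)
    next
      case 2
      then have i: "nat i \<in> {1..N}" "real_of_int i = real (nat i)" by auto
      have "w x i = x (nat i)" for x using 2 by (simp add: w_def)
      then show ?thesis by (simp only: i(2) restrict_apply'[OF i(1)])
    next
      case 3
      then show ?thesis using G0_outside[OF f(1), of "real_of_int i / real (Suc N)"]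
        by (simp add: w_def divide_neg_pos)
    next
      case 4
      then have "real (Suc N) \<le> real_of_int i" by linarith
      then have "1 \<le> real_of_int i / real (Suc N)" by (simp add: le_divide_eq)
      then show ?thesis using G0_outside[OF f(1), of "real_of_int i / real (Suc N)"] 4
        by (simp add: w_def)
    qed
  qed
  have ae: "AE g in Q. g \<in> G0 \<and> g 0 = 0"
    using AE_Q0_at_0[OF \<beta> Q] AE_space is_Q0D(3)[OF Q] by auto
  have "emeasure Q {g \<in> space Q. \<forall>s\<in>J. k (g (real_of_int \<lceil>real (Suc N) * s\<rceil> / real (Suc N))) < c s} =
      (\<integral>\<^sup>+g. indicator {g \<in> space Q. \<forall>s\<in>J. k (g (real_of_int \<lceil>real (Suc N) * s\<rceil> / real (Suc N))) < c s} g \<partial>Q)"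
  proof (rule nn_integral_indicator[symmetric])
    have [measurable]: "(\<lambda>g. k (g t)) \<in> borel_measurable Q" for t
      using measurable_compose[OF measurable_k_comp measurable_G0M_eval, of t] is_Q0D(2)[OF Q]
      by (simp cong: measurable_cong_sets)
    show "{g \<in> space Q. \<forall>s\<in>J. k (g (real_of_int \<lceil>real (Suc N) * s\<rceil> / real (Suc N))) < c s} \<in> sets Q"
      using J by (rule sets_Collect_ball_less) measurable
  qed
  also have "\<dots> = (\<integral>\<^sup>+g. U (\<lambda>i\<in>{1..N}. k (g (real i / real (Suc N)))) \<partial>Q)"
  proof (rule nn_integral_cong_AE)
    show "AE g in Q. indicator {g \<in> space Q. \<forall>s\<in>J. k (g (real_of_int \<lceil>real (Suc N) * s\<rceil> / real (Suc N))) < c s} g =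
        U (\<lambda>i\<in>{1..N}. k (g (real i / real (Suc N))))"
      using ae
    proof eventually_elim
      case (elim g)
      then have "k (g (real_of_int i / real (Suc N))) = w (\<lambda>i\<in>{1..N}. k (g (real i / real (Suc N)))) i" for i
        using w[OF k_comp_G0, of g i] by simp
      then show ?case using elim by (simp add: U_def indicator_def is_Q0D(3)[OF Q])
    qed
  qed
  also have "\<dots> = (\<integral>\<^sup>+g. ennreal (grid_density \<beta> N (\<lambda>i\<in>{1..N}. g (real i / real (Suc N)))) *
      U (\<lambda>i\<in>{1..N}. g (real i / real (Suc N))) \<partial>Q)"
    by (rule fdd_translation[OF Q U])
  also have "\<dots> = (\<integral>\<^sup>+g. ennreal (grid_Y \<beta> (Suc N) g) *
      indicator {g. \<forall>s\<in>J. g (real_of_int \<lceil>real (Suc N) * s\<rceil> / real (Suc N)) < c s} g \<partial>Q)"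
  proof (rule nn_integral_cong_AE)
    show "AE g in Q. ennreal (grid_density \<beta> N (\<lambda>i\<in>{1..N}. g (real i / real (Suc N)))) *
        U (\<lambda>i\<in>{1..N}. g (real i / real (Suc N))) = ennreal (grid_Y \<beta> (Suc N) g) *
        indicator {g. \<forall>s\<in>J. g (real_of_int \<lceil>real (Suc N) * s\<rceil> / real (Suc N)) < c s} g"
      using ae
    proof eventually_elim
      case (elim g)
      then show ?case
        using w[of g] grid_density_eq_grid_Y[of g \<beta> N] by (simp add: U_def indicator_def)
    qed
  qed
  finally show ?thesis .
qed

text \<open>Both measures are compared on the intersection-stable generator \<open>E\<close>. The
  identity holds for the event read off at the right ends of grid cells, and both sides converge as
  the mesh tends to 0.\<close>

lemma distr_translation:
  assumes \<beta>: "0 < \<beta>" and Q: "is_Q0 \<beta> Q"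
  shows "distr Q G0M (\<lambda>g. k \<circ> g) = density Q (\<lambda>g. ennreal (Yb0 \<beta> h h' g))"
proof -
  interpret prob_space Q by (rule is_Q0D(1)[OF Q])
  note spQ = is_Q0D(3)[OF Q] and setsQ = is_Q0D(2)[OF Q]
  note [measurable] = measurable_grid_Y[OF Q] measurable_is_Q0_eval[OF Q]
  have [measurable_cong]: "sets Q = sets G0M" by (rule setsQ)
  have comp: "(\<lambda>g. k \<circ> g) \<in> measurable Q G0M"
    using measurable_k_comp setsQ by (simp cong: measurable_cong_sets)
  have km[measurable]: "(\<lambda>g. k (g t)) \<in> borel_measurable Q" for t
    using measurable_compose[OF comp measurable_G0M_eval, of t] by simp
  \<comment> \<open>A measurable version of \<open>Yb0\<close>: \<open>lim\<close> of measurable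
    functions is measurable, and it agrees with \<open>Yb0\<close> on the almost sure set where the
    path has no jump at the endpoints.\<close>
  define Y where "Y = (\<lambda>g. lim (\<lambda>n. grid_Y \<beta> n g))"
  have Y[measurable]: "Y \<in> borel_measurable Q" unfolding Y_def by measurable
  have ae: "AE g in Q. g \<in> G0 \<and> (\<lambda>n. grid_Y \<beta> n g) \<longlonglongrightarrow> Y g \<and> Y g = Yb0 \<beta> h h' g"
    using AE_Q0_at_0[OF \<beta> Q] AE_Q0_sup[OF \<beta> Q] AE_space
  proof eventually_elim
    case (elim g)
    then show ?case
      using tendsto_grid_Y[of g \<beta>] spQ by (auto simp: Y_def limI)
  qed
  obtain L where L: "\<And>n g. g \<in> G0 \<Longrightarrow> \<bar>Phi_grid n g\<bar> \<le> L"
    using Phi_grid_bound by metis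
  obtain M where M: "\<And>n g. g \<in> G0 \<Longrightarrow> \<bar>Lam_grid n g\<bar> \<le> M"
    using Lam_grid_bound by metis
  define C where "C = exp (\<beta> * M + L) / sqrt (h' 0 * h' 1)"
  have C: "grid_Y \<beta> n g \<le> C" if "g \<in> G0" for n g
    unfolding grid_Y_def C_def using exp_div_sqrt_bounds(2)[OF \<beta> M[OF that] L[OF that]] .
  define E where "E = {{g \<in> G0. \<forall>s\<in>J. g s < c s} |J c. finite J}"
  \<comment> \<open>No measurability of \<open>Yb0\<close> is needed here: its lower integral agrees with the integral of \<open>Y\<close>.\<close>
  have dens: "emeasure (density Q (\<lambda>g. ennreal (Yb0 \<beta> h h' g))) = emeasure (density Q (\<lambda>g. ennreal (Y g)))"
  proof -
    have "(\<integral>\<^sup>+g. ennreal (Yb0 \<beta> h h' g) * indicator A g \<partial>Q) = (\<integral>\<^sup>+g. ennreal (Y g) * indicator A g \<partial>Q)" for A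
      by (rule nn_integral_cong_AE) (use ae in eventually_elim, auto)
    then show ?thesis by (simp add: density_def)
  qed
  show ?thesis
  proof (rule measure_eqI_generator_eq)
    show "Int_stable E"
    proof (rule Int_stableI)
      fix A B assume "A \<in> E" "B \<in> E"
      then obtain J c K d where AB: "A = {g \<in> G0. \<forall>s\<in>J. g s < c s}" "finite J"
          "B = {g \<in> G0. \<forall>s\<in>K. g s < d s}" "finite K"
        unfolding E_def by blast
      \<comment> \<open>Times common to both events receive the smaller bound, so the intersection
        is again of the generating form.\<close>
      define e where "e = (\<lambda>s. if s \<in> J \<and> s \<in> K then min (c s) (d s) else if s \<in> J then c s else d s)"
      have "A \<inter> B = {g \<in> G0. \<forall>s\<in>J \<union> K. g s < e s}"
        unfolding AB e_def by auto
      then show "A \<inter> B \<in> E" unfolding E_def using AB by blast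
    qed
    show "E \<subseteq> Pow G0" by (auto simp: E_def)
    show "sets (distr Q G0M (\<lambda>g. k \<circ> g)) = sigma_sets G0 E"
      "sets (density Q (\<lambda>g. ennreal (Yb0 \<beta> h h' g))) = sigma_sets G0 E"
      using sets_G0M_eq setsQ by (auto simp: E_def)
    have "G0 \<in> E" unfolding E_def by (rule CollectI, rule exI[of _ "{}"]) auto
    then show "range (\<lambda>_ :: nat. G0) \<subseteq> E" "(\<Union>i :: nat. G0) = G0" by auto
    have "prob_space (distr Q G0M (\<lambda>g. k \<circ> g))" by (rule prob_space_distr[OF comp])
    then show "emeasure (distr Q G0M (\<lambda>g. k \<circ> g)) G0 \<noteq> \<infinity>"
      using finite_measure.emeasure_finite prob_space.axioms(1) by (metis infinity_ennreal_def)
    fix X assume "X \<in> E"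
    then obtain J c where X: "X = {g \<in> G0. \<forall>s\<in>J. g s < c s}" and J: "finite J"
      unfolding E_def by blast
    have XQ: "X \<in> sets Q"
      using \<open>X \<in> E\<close> sets_G0M_eq setsQ by (auto simp: E_def)
    define r where "r = (\<lambda>n s. real_of_int \<lceil>real (Suc n) * s\<rceil> / real (Suc n))"
    have ev: "\<forall>\<^sub>F n in sequentially. (\<forall>s\<in>J. g (r n s) < c s) \<longleftrightarrow> (\<forall>s\<in>J. g s < c s)" if "g \<in> G0" for g
    proof -
      have "\<forall>\<^sub>F n in sequentially. \<forall>s\<in>J. g (r n s) < c s \<longleftrightarrow> g s < c s"
        unfolding r_def
        using J eventually_ceiling_grid_less[OF that, THEN eventually_sequentially_Suc[THEN iffD2]]
        by (intro eventually_ball_finite) auto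
      then show ?thesis by eventually_elim blast
    qed
    have S1[measurable]: "{g \<in> space Q. \<forall>s\<in>J. k (g (r n s)) < c s} \<in> sets Q" for n
      using J by (rule sets_Collect_ball_less) measurable
    have S2[measurable]: "{g \<in> space Q. \<forall>s\<in>J. k (g s) < c s} \<in> sets Q"
      using J by (rule sets_Collect_ball_less) measurable
    have S3[measurable]: "{g \<in> space Q. \<forall>s\<in>J. g (r n s) < c s} \<in> sets Q" for n
      using J by (rule sets_Collect_ball_less) measurable
    have "(\<lambda>n. \<integral>\<^sup>+g. indicator {g \<in> space Q. \<forall>s\<in>J. k (g (r n s)) < c s} g \<partial>Q) \<longlonglongrightarrow>
        (\<integral>\<^sup>+g. indicator {g \<in> space Q. \<forall>s\<in>J. k (g s) < c s} g \<partial>Q)"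
    proof (rule nn_integral_dominated_convergence[where w="\<lambda>_. 1"])
      show "AE g in Q. (\<lambda>n. indicator {g \<in> space Q. \<forall>s\<in>J. k (g (r n s)) < c s} g) \<longlonglongrightarrow>
          (indicator {g \<in> space Q. \<forall>s\<in>J. k (g s) < c s} g :: ennreal)"
      proof (rule AE_I2)
        fix g assume "g \<in> space Q"
        then have "k \<circ> g \<in> G0" using spQ k_comp_G0 by simp
        from ev[OF this] show "(\<lambda>n. indicator {g \<in> space Q. \<forall>s\<in>J. k (g (r n s)) < c s} g) \<longlonglongrightarrow>
          (indicator {g \<in> space Q. \<forall>s\<in>J. k (g s) < c s} g :: ennreal)"
          by (intro tendsto_eventually, eventually_elim) (simp add: indicator_def)
      qed
    qed (auto simp: indicator_def emeasure_space_1)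
    then have lim1: "(\<lambda>n. emeasure Q {g \<in> space Q. \<forall>s\<in>J. k (g (r n s)) < c s}) \<longlonglongrightarrow>
        emeasure Q {g \<in> space Q. \<forall>s\<in>J. k (g s) < c s}"
      by simp
    \<comment> \<open>The densities are bounded by \<open>C\<close> uniformly in \<open>n\<close>
      and \<open>g\<close>, and for each path the grid event eventually coincides with membership in
      \<open>X\<close>.\<close>
    have lim2: "(\<lambda>n. \<integral>\<^sup>+g. ennreal (grid_Y \<beta> (Suc n) g) * indicator {g \<in> space Q. \<forall>s\<in>J. g (r n s) < c s} g \<partial>Q) \<longlonglongrightarrow>
        (\<integral>\<^sup>+g. ennreal (Y g) * indicator X g \<partial>Q)"
    proof (rule nn_integral_dominated_convergence[where w="\<lambda>_. ennreal C"])
      show "AE g in Q. (\<lambda>n. ennreal (grid_Y \<beta> (Suc n) g) * indicator {g \<in> space Q. \<forall>s\<in>J. g (r n s) < c s} g) \<longlonglongrightarrow>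
          ennreal (Y g) * indicator X g"
        using ae
      proof eventually_elim
        case (elim g)
        then have "(\<lambda>n. ennreal (grid_Y \<beta> (Suc n) g)) \<longlonglongrightarrow> ennreal (Y g)"
          by (intro tendsto_ennrealI LIMSEQ_Suc) auto
        then have "(\<lambda>n. ennreal (grid_Y \<beta> (Suc n) g) * indicator X g) \<longlonglongrightarrow> ennreal (Y g) * indicator X g"
          by (cases "g \<in> X") auto
        moreover have "\<forall>\<^sub>F n in sequentially. ennreal (grid_Y \<beta> (Suc n) g) * indicator {g \<in> space Q. \<forall>s\<in>J. g (r n s) < c s} g =
            ennreal (grid_Y \<beta> (Suc n) g) * indicator X g"
          using ev[of g] elim by (auto elim!: eventually_mono simp: X indicator_def spQ)
        ultimately show ?case
          by (simp only: tendsto_cong)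
      qed
      show "AE g in Q. ennreal (grid_Y \<beta> (Suc n) g) * indicator {g \<in> space Q. \<forall>s\<in>J. g (r n s) < c s} g \<le> ennreal C" for n
        using C by (intro AE_I2) (auto simp: spQ indicator_def intro: ennreal_leI)
      show "(\<integral>\<^sup>+g. ennreal C \<partial>Q) < \<infinity>" by (simp add: emeasure_space_1)
    qed (use XQ in measurable)
    have "emeasure Q {g \<in> space Q. \<forall>s\<in>J. k (g (r n s)) < c s} =
        (\<integral>\<^sup>+g. ennreal (grid_Y \<beta> (Suc n) g) * indicator {g \<in> space Q. \<forall>s\<in>J. g (r n s) < c s} g \<partial>Q)" for n
      unfolding r_def grid_translation[OF \<beta> Q J]
      by (intro nn_integral_cong) (auto simp: indicator_def)
    with lim1 lim2 have "emeasure Q {g \<in> space Q. \<forall>s\<in>J. k (g s) < c s} = (\<integral>\<^sup>+g. ennreal (Y g) * indicator X g \<partial>Q)"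
      by (intro LIMSEQ_unique) auto
    moreover have "emeasure (distr Q G0M (\<lambda>g. k \<circ> g)) X = emeasure Q {g \<in> space Q. \<forall>s\<in>J. k (g s) < c s}"
      using XQ setsQ k_comp_G0
      by (subst emeasure_distr[OF comp]) (auto simp: X spQ intro!: arg_cong[where f="emeasure Q"])
    moreover have "emeasure (density Q (\<lambda>g. ennreal (Yb0 \<beta> h h' g))) X = (\<integral>\<^sup>+g. ennreal (Y g) * indicator X g \<partial>Q)"
      unfolding dens by (intro emeasure_density measurable_compose[OF Y measurable_ennreal] XQ)
    ultimately show "emeasure (distr Q G0M (\<lambda>g. k \<circ> g)) X = emeasure (density Q (\<lambda>g. ennreal (Yb0 \<beta> h h' g))) X"
      by simp
  qed
qed

end

theorem theorem4p3:
  fixes \<beta> :: real and h h' :: "real \<Rightarrow> real" and Q :: "(real \<Rightarrow> real) measure"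
  assumes "\<beta> > 0"
    and "C2_iso h h'"
    and "is_Q0 \<beta> Q"
  shows "distr Q G0M (\<lambda>g. the_inv_into {0..1} h \<circ> g) =
           density Q (\<lambda>g. ennreal (Yb0 \<beta> h h' g)) \<and>
         (\<exists>c C. 0 < c \<and> (\<forall>g\<in>G0. c \<le> Yb0 \<beta> h h' g \<and> Yb0 \<beta> h h' g \<le> C))"
proof -
  obtain h'' where "C2_iso01 h h' h''"
    using assms(2) unfolding C2_iso_def C2_on01_def C2_iso01_def by blast
  then interpret C2_iso01 h h' h'' .
  show ?thesis
    using distr_translation[OF assms(1,3)] Yb0_bounds[OF assms(1)] by blast
qed

end
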